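(* Let $n\ge 1$ and let $g$ be the Semi-Riemannian metric on $GL_n=GL_n(\mathbb{R})$ given by $g_A(V,W)=\mathrm{tr}(A^{-1}VA^{-1}W)$ for $A\in GL_n$, $V,W\in T_A(GL_n)=M_n(\mathbb{R})$; denote also by $g$ its restrictions to submanifolds. The manifold $(GL_n^+,g)$, with $GL_n^+=\{A\in GL_n:\det(A)>0\}$, is an open Semi-Riemannian submanifold of $(GL_n,g)$, isometric to the Semi-Riemannian product manifold $(SL_n\times\mathbb{R},g\times h)$, where $SL_n=SL_n(\mathbb{R})$ and $h=dx^2$ is the euclidean metric on $\mathbb{R}$.
   Context: $SL_n(\mathbb{R})$ is the group of real $n\times n$ matrices of determinant $1$, with $T_P(SL_n)=\{V\in M_n(\mathbb{R}):\mathrm{tr}(P^{-1}V)=0\}$. The product metric is $(g\times h)_{(P,x)}((V,a),(V',a'))=\mathrm{tr}(P^{-1}VP^{-1}V')+aa'$ for $P\in SL_n$, $x\in\mathbb{R}$, $V,V'\in T_P(SL_n)$ and $a,a'\in T_x\mathbb{R}=\mathbb{R}$. *)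

theory Defs
  imports "HOL-Analysis.Analysis"
begin

text \<open>
  Manifolds are embedded submanifolds of a Euclidean space, so a tangent vector is a vector of the
  ambient space.  A tensor field of type (0,2) on \<open>M\<close> is a function \<open>g p v w\<close> of which only the values
  at \<open>p \<in> M\<close> and \<open>v, w\<close> tangent to \<open>M\<close> at \<open>p\<close> are relevant.  Hence the restriction of a metric
  to a submanifold is denoted by the same function.
\<close>

section \<open>Smooth maps\<close>

text \<open>Meant for open \<open>S\<close>: iterated directional derivatives of order less than \<open>k\<close> are (Frechet)
  differentiable on \<open>S\<close>, and those of order \<open>k\<close> are continuous.\<close>

primrec C_k_on :: "nat \<Rightarrow> ('a::euclidean_space \<Rightarrow> 'b::euclidean_space) \<Rightarrow> 'a set \<Rightarrow> bool" where
  "C_k_on 0 f S \<longleftrightarrow> continuous_on S f"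
| "C_k_on (Suc k) f S \<longleftrightarrow> (\<forall>x\<in>S. f differentiable (at x)) \<and>
     (\<forall>v. C_k_on k (\<lambda>x. frechet_derivative f (at x) v) S)"

definition smooth_on :: "('a::euclidean_space \<Rightarrow> 'b::euclidean_space) \<Rightarrow> 'a set \<Rightarrow> bool" where
  "smooth_on f S \<longleftrightarrow> (\<forall>k. C_k_on k f S)"

text \<open>Smoothness on an arbitrary subset: local extendability to smooth maps on open sets.
  For an open subset this is the same as \<^const>\<open>smooth_on\<close>.\<close>

definition smooth_map :: "'a::euclidean_space set \<Rightarrow> ('a \<Rightarrow> 'b::euclidean_space) \<Rightarrow> bool" where
  "smooth_map M f \<longleftrightarrow>
     (\<forall>p\<in>M. \<exists>U f'. open U \<and> p \<in> U \<and> smooth_on f' U \<and> (\<forall>x\<in>M \<inter> U. f x = f' x))"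

definition diffeomorphism ::
  "'a::euclidean_space set \<Rightarrow> 'b::euclidean_space set \<Rightarrow> ('a \<Rightarrow> 'b) \<Rightarrow> ('b \<Rightarrow> 'a) \<Rightarrow> bool" where
  "diffeomorphism M N F G \<longleftrightarrow> smooth_map M F \<and> smooth_map N G \<and> F ` M = N \<and> G ` N = M \<and>
     (\<forall>x\<in>M. G (F x) = x) \<and> (\<forall>y\<in>N. F (G y) = y)"

section \<open>Embedded submanifolds and tangent spaces\<close>

definition embedded_submanifold :: "nat \<Rightarrow> 'a::euclidean_space set \<Rightarrow> bool" where
  "embedded_submanifold d M \<longleftrightarrow>
     (\<forall>p\<in>M. \<exists>U V \<phi> \<psi> L. open U \<and> p \<in> U \<and> open V \<and> diffeomorphism U (V::'a set) \<phi> \<psi> \<and>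
        subspace L \<and> dim L = d \<and> \<phi> ` (M \<inter> U) = V \<inter> L)"

definition curve_at :: "'a::euclidean_space set \<Rightarrow> 'a \<Rightarrow> 'a \<Rightarrow> (real \<Rightarrow> 'a) \<Rightarrow> bool" where
  "curve_at M p v \<gamma> \<longleftrightarrow>
     (\<exists>e>0. smooth_on \<gamma> {-e<..<e} \<and> \<gamma> ` {-e<..<e} \<subseteq> M) \<and>
     \<gamma> 0 = p \<and> (\<gamma> has_vector_derivative v) (at 0)"

definition tangent_space :: "'a::euclidean_space set \<Rightarrow> 'a \<Rightarrow> 'a set" where
  "tangent_space M p = {v. \<exists>\<gamma>. curve_at M p v \<gamma>}"

definition differential ::
  "'a::euclidean_space set \<Rightarrow> ('a \<Rightarrow> 'b::euclidean_space) \<Rightarrow> 'a \<Rightarrow> 'a \<Rightarrow> 'b" where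
  "differential M F p v =
     (THE w. \<exists>\<gamma>. curve_at M p v \<gamma> \<and> (F \<circ> \<gamma> has_vector_derivative w) (at 0))"

section \<open>Semi-Riemannian manifolds\<close>

type_synonym 'a tensor = "'a \<Rightarrow> 'a \<Rightarrow> 'a \<Rightarrow> real"

definition symmetric_bilinear_on :: "'a::real_vector set \<Rightarrow> ('a \<Rightarrow> 'a \<Rightarrow> real) \<Rightarrow> bool" where
  "symmetric_bilinear_on T b \<longleftrightarrow>
     (\<forall>v\<in>T. \<forall>w\<in>T. b v w = b w v) \<and>
     (\<forall>u\<in>T. \<forall>v\<in>T. \<forall>w\<in>T. b (u + v) w = b u w + b v w) \<and>
     (\<forall>c. \<forall>v\<in>T. \<forall>w\<in>T. b (c *\<^sub>R v) w = c * b v w)"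

definition nondegenerate_on :: "'a::real_vector set \<Rightarrow> ('a \<Rightarrow> 'a \<Rightarrow> real) \<Rightarrow> bool" where
  "nondegenerate_on T b \<longleftrightarrow> (\<forall>v\<in>T. (\<forall>w\<in>T. b v w = 0) \<longrightarrow> v = 0)"

definition index_on :: "'a::euclidean_space set \<Rightarrow> ('a \<Rightarrow> 'a \<Rightarrow> real) \<Rightarrow> nat" where
  "index_on T b = Max {dim W | W. subspace W \<and> W \<subseteq> T \<and> (\<forall>w\<in>W. w \<noteq> 0 \<longrightarrow> b w w < 0)}"

definition vector_field :: "'a::euclidean_space set \<Rightarrow> ('a \<Rightarrow> 'a) \<Rightarrow> bool" where
  "vector_field M X \<longleftrightarrow> smooth_map M X \<and> (\<forall>p\<in>M. X p \<in> tangent_space M p)"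

definition semi_riemannian_metric :: "'a::euclidean_space set \<Rightarrow> 'a tensor \<Rightarrow> bool" where
  "semi_riemannian_metric M g \<longleftrightarrow>
     (\<forall>p\<in>M. symmetric_bilinear_on (tangent_space M p) (g p) \<and>
            nondegenerate_on (tangent_space M p) (g p)) \<and>
     (\<exists>\<nu>. \<forall>p\<in>M. index_on (tangent_space M p) (g p) = \<nu>) \<and>
     (\<forall>X Y. vector_field M X \<and> vector_field M Y \<longrightarrow> smooth_map M (\<lambda>p. g p (X p) (Y p)))"

definition semi_riemannian_manifold :: "'a::euclidean_space set \<Rightarrow> 'a tensor \<Rightarrow> bool" where
  "semi_riemannian_manifold M g \<longleftrightarrow>
     (\<exists>d. embedded_submanifold d M) \<and> semi_riemannian_metric M g"

definition open_semi_riemannian_submanifold ::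
  "'a::euclidean_space set \<Rightarrow> 'a set \<Rightarrow> 'a tensor \<Rightarrow> bool" where
  "open_semi_riemannian_submanifold M N g \<longleftrightarrow>
     semi_riemannian_manifold N g \<and> semi_riemannian_manifold M g \<and> openin (top_of_set N) M"

definition isometry_between ::
  "'a::euclidean_space set \<Rightarrow> 'a tensor \<Rightarrow> 'b::euclidean_space set \<Rightarrow> 'b tensor \<Rightarrow> ('a \<Rightarrow> 'b) \<Rightarrow> bool"
  where
  "isometry_between M g N h F \<longleftrightarrow> (\<exists>G. diffeomorphism M N F G) \<and>
     (\<forall>p\<in>M. \<forall>v\<in>tangent_space M p. \<forall>w\<in>tangent_space M p.
        h (F p) (differential M F p v) (differential M F p w) = g p v w)"

definition isometric ::
  "'a::euclidean_space set \<Rightarrow> 'a tensor \<Rightarrow> 'b::euclidean_space set \<Rightarrow> 'b tensor \<Rightarrow> bool" where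
  "isometric M g N h \<longleftrightarrow> (\<exists>F. isometry_between M g N h F)"

definition product_metric :: "'a tensor \<Rightarrow> 'b tensor \<Rightarrow> ('a \<times> 'b) tensor" where
  "product_metric g h = (\<lambda>(p, x) (v, a) (w, b). g p v w + h x a b)"

section \<open>Matrix groups\<close>

definition GL :: "(real^'n^'n) set" where
  "GL = {A. invertible A}"

definition GL_pos :: "(real^'n^'n) set" where
  "GL_pos = {A \<in> GL. det A > 0}"

definition SL :: "(real^'n^'n) set" where
  "SL = {A. det A = 1}"

definition trace_metric :: "(real^'n^'n) tensor" where
  "trace_metric A V W = trace (matrix_inv A ** V ** matrix_inv A ** W)"

definition line_metric :: "real tensor" where
  "line_metric x a b = a * b"

end

theory Submission
  imports Defs
begin

text \<open>
  The isometry sends \<open>A\<close> to \<open>(det A\<^bsup>-1/n\<^esup> A, ln (det A) / \<surd>n)\<close>, with inverse \<open>(P, x) \<mapsto> exp (x / \<surd>n) P\<close>.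
  For \<open>X = A\<^sup>-\<^sup>1 V\<close>, the first component contributes the trace-free part \<open>X - (tr X / n) 1\<close> of \<open>X\<close> and
  the second one \<open>tr X / \<surd>n\<close>; these parts are orthogonal for the trace form, and \<open>(tr X / n) 1\<close> has square
  \<open>(tr X)\<^sup>2 / n\<close>.  Left translation by \<open>A\<^sup>-\<^sup>1\<close> identifies each tangent space with a fixed space of
  matrices carrying the trace form, so that the index is constant.  The charts of \<open>SL\<close> use that
  the determinant is affine in each matrix entry.
\<close>

section \<open>Calculus of smooth maps\<close>

text \<open>The factor 1/sqrt n is an arc length: the scaling curve exp(t) A has velocity A at t =
  0, and \<open>trace_metric A A A\<close> is the trace of the identity, n. So t = ln (det A) / n
  must be stretched by sqrt n to become the euclidean coordinate. Tangent vectors are velocities of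
  smooth curves, so showing that a vector is tangent to \<open>SL\<close> requires a curve that
  stays in \<open>SL\<close>. The normalisation used as first component of the isometry also serves
  here: it is a smooth retraction of \<open>GL_pos\<close> onto \<open>SL\<close>, and straight
  lines pushed through it give the curves. The reverse inclusion comes from the constancy of the
  determinant. The trace form is indefinite as soon as n > 1, so nondegeneracy cannot come from
  positivity of the form itself. Pairing a matrix with its transpose produces the Frobenius norm,
  and transposition keeps the trace, so the same test vector works on \<open>GL\<close> and on
  \<open>SL\<close>.\<close>

lemma C_k_on_cong_imp:
  assumes "open S"
  shows "C_k_on k f S \<Longrightarrow> (\<And>x. x \<in> S \<Longrightarrow> f x = g x) \<Longrightarrow> C_k_on k g S"
proof (induction k arbitrary: f g)
  case 0
  then show ?case using continuous_on_cong[of S S f g] by simp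
next
  case (Suc k)
  \<comment> \<open>Derivatives are taken \<open>at x\<close>, not \<open>at x within S\<close>;
    openness of \<open>S\<close> makes them depend on the values on \<open>S\<close> only.\<close>
  have d: "(g has_derivative frechet_derivative f (at x)) (at x)" if "x \<in> S" for x
  proof (rule has_derivative_transform_within_open[OF _ assms that Suc.prems(2)])
    show "(f has_derivative frechet_derivative f (at x)) (at x)"
      using Suc.prems(1) that by (simp flip: frechet_derivative_works)
  qed
  then have e: "frechet_derivative f (at x) = frechet_derivative g (at x)" if "x \<in> S" for x
    using frechet_derivative_at[OF d[OF that]] by simp
  have "C_k_on k (\<lambda>x. frechet_derivative g (at x) v) S" for v
    by (rule Suc.IH[of "\<lambda>x. frechet_derivative f (at x) v"]) (use Suc.prems e in simp_all)
  then show ?case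
    using d by (auto simp: differentiable_def)
qed

lemma C_k_on_cong:
  assumes "open S" "\<And>x. x \<in> S \<Longrightarrow> f x = g x"
  shows "C_k_on k f S \<longleftrightarrow> C_k_on k g S"
  using C_k_on_cong_imp[OF assms(1), of k f g] C_k_on_cong_imp[OF assms(1), of k g f] assms(2)
  by auto

text \<open>\<open>frechet_derivative\<close> is a choice operator. This rule admits any explicit
  derivative \<open>D\<close> instead, and the closure proofs below go through it.\<close>

lemma C_k_on_SucI:
  assumes "open S" "\<And>x. x \<in> S \<Longrightarrow> (f has_derivative D x) (at x)"
    and "\<And>v. C_k_on k (\<lambda>x. D x v) S"
  shows "C_k_on (Suc k) f S"
proof -
  have e: "frechet_derivative f (at x) = D x" if "x \<in> S" for x
    using frechet_derivative_at[OF assms(2)[OF that]] by simp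
  have "C_k_on k (\<lambda>x. frechet_derivative f (at x) v) S" for v
    by (subst C_k_on_cong[OF assms(1), where g = "\<lambda>x. D x v"]) (simp_all add: e assms(3))
  then show ?thesis
    using assms(2) by (auto simp: differentiable_def)
qed

text \<open>The product and chain rules leave one factor undifferentiated, and their induction
  hypotheses ask for that factor at the lower order.\<close>

lemma C_k_on_SucD: "C_k_on (Suc k) f S \<Longrightarrow> C_k_on k f S"
proof (induction k arbitrary: f)
  case 0
  then have "f differentiable_on S"
    by (simp add: differentiable_on_def differentiable_at_withinI)
  then show ?case by (simp add: differentiable_imp_continuous_on)
next
  case (Suc k)
  have "C_k_on k (\<lambda>x. frechet_derivative f (at x) v) S" for v
    by (rule Suc.IH) (use Suc.prems in simp)
  then show ?case using Suc.prems by simp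
qed

lemma C_k_on_has_derivative:
  "C_k_on (Suc k) f S \<Longrightarrow> x \<in> S \<Longrightarrow> (f has_derivative frechet_derivative f (at x)) (at x)"
  by (simp flip: frechet_derivative_works)

lemma C_k_on_subset:
  assumes "T \<subseteq> S" shows "C_k_on k f S \<Longrightarrow> C_k_on k f T"
proof (induction k arbitrary: f)
  case 0
  then show ?case using assms continuous_on_subset by simp
next
  case (Suc k)
  then show ?case using assms by (simp add: subset_iff)
qed

lemma C_k_on_const: "C_k_on k (\<lambda>x. c) S"
  by (induction k arbitrary: c) auto

lemma C_k_on_bounded_linear:
  assumes "open S" "bounded_linear L"
  shows "C_k_on k f S \<Longrightarrow> C_k_on k (\<lambda>x. L (f x)) S"
proof (induction k arbitrary: f)
  case 0
  then show ?case
    using assms(2) by (auto intro: bounded_linear.continuous_on)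
next
  case (Suc k)
  show ?case
    by (rule C_k_on_SucI[OF assms(1) bounded_linear.has_derivative[OF assms(2)
            C_k_on_has_derivative[OF Suc.prems]]]) (use Suc in auto)
qed

lemma C_k_on_id:
  assumes "open S" shows "C_k_on k (\<lambda>x. x) S"
proof (cases k)
  case (Suc m)
  show ?thesis unfolding Suc
    by (rule C_k_on_SucI[OF assms, where D = "\<lambda>x v. v"])
      (auto intro: C_k_on_const)
qed auto

lemma C_k_on_add:
  assumes "open S"
  shows "C_k_on k f S \<Longrightarrow> C_k_on k g S \<Longrightarrow> C_k_on k (\<lambda>x. f x + g x) S"
proof (induction k arbitrary: f g)
  case 0
  then show ?case by (auto intro!: continuous_intros)
next
  case (Suc k)
  show ?case
    by (rule C_k_on_SucI[OF assms has_derivative_add[OF C_k_on_has_derivative[OF Suc.prems(1)]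
            C_k_on_has_derivative[OF Suc.prems(2)]]]) (use Suc in auto)
qed

lemma C_k_on_bounded_bilinear:
  assumes "open S" "bounded_bilinear B"
  shows "C_k_on k f S \<Longrightarrow> C_k_on k g S \<Longrightarrow> C_k_on k (\<lambda>x. B (f x) (g x)) S"
proof (induction k arbitrary: f g)
  case 0
  then show ?case using assms(2) by (auto intro: bounded_bilinear.continuous_on)
next
  case (Suc k)
  show ?case
    by (rule C_k_on_SucI[OF assms(1) bounded_bilinear.FDERIV[OF assms(2)
            C_k_on_has_derivative[OF Suc.prems(1)] C_k_on_has_derivative[OF Suc.prems(2)]]])
      (use Suc.prems Suc.prems[THEN C_k_on_SucD] in
        \<open>auto intro!: C_k_on_add[OF assms(1)] Suc.IH\<close>)
qed

lemma C_k_on_sum: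
  assumes "open S" "finite I" "\<And>i. i \<in> I \<Longrightarrow> C_k_on k (f i) S"
  shows "C_k_on k (\<lambda>x. \<Sum>i\<in>I. f i x) S"
  using assms(2,3)
  by (induction I rule: finite_induct) (auto intro!: C_k_on_const C_k_on_add[OF assms(1)])

text \<open>In the chain rule the direction \<open>Df x v\<close> itself varies with
  \<open>x\<close>, whereas the definition controls the derivative of \<open>g\<close> only in fixed
  directions. Expanding the direction in \<open>Basis\<close> gives a sum of scalar functions times
  derivatives in fixed directions, to which the induction hypothesis and the product rule
  apply.\<close>

lemma C_k_on_compose:
  fixes f :: "'a::euclidean_space \<Rightarrow> 'b::euclidean_space" and g :: "'b \<Rightarrow> 'c::euclidean_space"
  assumes "open S" "open T" "f ` S \<subseteq> T"
  shows "C_k_on k g T \<Longrightarrow> C_k_on k f S \<Longrightarrow> C_k_on k (\<lambda>x. g (f x)) S"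
proof (induction k arbitrary: g)
  case 0
  then show ?case using assms(3) by (auto intro: continuous_on_compose2)
next
  case (Suc k)
  define Dg where "Dg y = frechet_derivative g (at y)" for y
  define Df where "Df x = frechet_derivative f (at x)" for x
  have Dg: "(g has_derivative Dg y) (at y)" if "y \<in> T" for y
    using Suc.prems(1) that unfolding Dg_def by (rule C_k_on_has_derivative)
  have Df: "(f has_derivative Df x) (at x)" if "x \<in> S" for x
    using Suc.prems(2) that unfolding Df_def by (rule C_k_on_has_derivative)
  have fk: "C_k_on k f S" using Suc.prems(2) by (rule C_k_on_SucD)
  show ?case
  proof (rule C_k_on_SucI[OF assms(1)])
    fix x assume x: "x \<in> S"
    have lin: "linear (Dg (f x))"
      using has_derivative_linear[OF Dg, of "f x"] x assms(3) by blast
    have "((\<lambda>x. g (f x)) has_derivative (\<lambda>v. Dg (f x) (Df x v))) (at x)"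
      by (rule has_derivative_compose[OF Df[OF x] Dg]) (use x assms(3) in blast)
    also have "(\<lambda>v. Dg (f x) (Df x v)) = (\<lambda>v. \<Sum>b\<in>Basis. (Df x v \<bullet> b) *\<^sub>R Dg (f x) b)"
    proof
      fix v
      have "Dg (f x) (\<Sum>b\<in>Basis. (Df x v \<bullet> b) *\<^sub>R b) = (\<Sum>b\<in>Basis. (Df x v \<bullet> b) *\<^sub>R Dg (f x) b)"
        by (simp add: linear_sum[OF lin] linear_cmul[OF lin])
      then show "Dg (f x) (Df x v) = (\<Sum>b\<in>Basis. (Df x v \<bullet> b) *\<^sub>R Dg (f x) b)"
        by (simp add: euclidean_representation)
    qed
    finally show "((\<lambda>x. g (f x)) has_derivative \<dots>) (at x)" .
  next
    fix v
    have "C_k_on k (\<lambda>x. Dg (f x) b) S" for b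
      using Suc.prems(1) fk by (intro Suc.IH) (auto simp: Dg_def)
    moreover have "C_k_on k (\<lambda>x. Df x v \<bullet> b) S" for b
      using Suc.prems(2)
      by (intro C_k_on_bounded_linear[OF assms(1) bounded_linear_inner_left]) (auto simp: Df_def)
    ultimately show "C_k_on k (\<lambda>x. \<Sum>b\<in>Basis. (Df x v \<bullet> b) *\<^sub>R Dg (f x) b) S"
      by (intro C_k_on_sum C_k_on_bounded_bilinear[OF assms(1) bounded_bilinear_scaleR] assms) auto
  qed
qed

section \<open>Closure rules for smooth maps on open sets\<close>

named_theorems smooth_intros

lemma smooth_on_cong:
  "open S \<Longrightarrow> (\<And>x. x \<in> S \<Longrightarrow> f x = g x) \<Longrightarrow> smooth_on f S \<longleftrightarrow> smooth_on g S"
  by (simp add: smooth_on_def C_k_on_cong[of S f g])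

lemma smooth_on_subset: "smooth_on f S \<Longrightarrow> T \<subseteq> S \<Longrightarrow> smooth_on f T"
  by (simp add: smooth_on_def C_k_on_subset)

lemma smooth_on_imp_continuous_on: "smooth_on f S \<Longrightarrow> continuous_on S f"
  by (simp add: smooth_on_def flip: C_k_on.simps(1))

lemma smooth_on_const [smooth_intros]: "smooth_on (\<lambda>x. c) S"
  by (simp add: smooth_on_def C_k_on_const)

lemma smooth_on_id [smooth_intros]: "open S \<Longrightarrow> smooth_on (\<lambda>x. x) S"
  by (simp add: smooth_on_def C_k_on_id)

lemma smooth_on_add [smooth_intros]:
  "open S \<Longrightarrow> smooth_on f S \<Longrightarrow> smooth_on g S \<Longrightarrow> smooth_on (\<lambda>x. f x + g x) S"
  by (simp add: smooth_on_def C_k_on_add)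

lemma smooth_on_bounded_linear:
  "bounded_linear L \<Longrightarrow> open S \<Longrightarrow> smooth_on f S \<Longrightarrow> smooth_on (\<lambda>x. L (f x)) S"
  by (simp add: smooth_on_def C_k_on_bounded_linear)

lemma smooth_on_bounded_bilinear:
  "bounded_bilinear B \<Longrightarrow> open S \<Longrightarrow> smooth_on f S \<Longrightarrow> smooth_on g S \<Longrightarrow>
    smooth_on (\<lambda>x. B (f x) (g x)) S"
  by (simp add: smooth_on_def C_k_on_bounded_bilinear)

lemmas smooth_on_scaleR [smooth_intros] = smooth_on_bounded_bilinear[OF bounded_bilinear_scaleR]
lemmas smooth_on_mult [smooth_intros] =
  smooth_on_bounded_bilinear[OF bounded_bilinear_mult[where 'a = real]]
lemmas smooth_on_inner [smooth_intros] = smooth_on_bounded_bilinear[OF bounded_bilinear_inner]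
lemmas smooth_on_fst [smooth_intros] = smooth_on_bounded_linear[OF bounded_linear_fst]
lemmas smooth_on_snd [smooth_intros] = smooth_on_bounded_linear[OF bounded_linear_snd]
lemmas smooth_on_minus [smooth_intros] =
  smooth_on_bounded_linear[OF bounded_linear_minus[OF bounded_linear_ident]]
lemmas smooth_on_vec_nth [smooth_intros] = smooth_on_bounded_linear[OF bounded_linear_vec_nth]

lemma smooth_on_diff [smooth_intros]:
  "open S \<Longrightarrow> smooth_on f S \<Longrightarrow> smooth_on g S \<Longrightarrow> smooth_on (\<lambda>x. f x - g x) S"
  using smooth_on_add[of S f "\<lambda>x. - g x"] smooth_on_minus[of S g] by simp

lemma smooth_on_sum [smooth_intros]:
  "open S \<Longrightarrow> finite I \<Longrightarrow> (\<And>i. i \<in> I \<Longrightarrow> smooth_on (f i) S) \<Longrightarrow> smooth_on (\<lambda>x. \<Sum>i\<in>I. f i x) S"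
  by (simp add: smooth_on_def C_k_on_sum)

lemma smooth_on_prod [smooth_intros]:
  fixes f :: "'i \<Rightarrow> 'a::euclidean_space \<Rightarrow> real"
  assumes "open S" "finite I" "\<And>i. i \<in> I \<Longrightarrow> smooth_on (f i) S"
  shows "smooth_on (\<lambda>x. \<Prod>i\<in>I. f i x) S"
  using assms(2,3)
  by (induction I rule: finite_induct) (auto intro!: smooth_intros assms(1))

lemma smooth_on_compose:
  "smooth_on g T \<Longrightarrow> smooth_on f S \<Longrightarrow> open S \<Longrightarrow> open T \<Longrightarrow> f ` S \<subseteq> T \<Longrightarrow> smooth_on (\<lambda>x. g (f x)) S"
  by (simp add: smooth_on_def C_k_on_compose[of S T f])

lemma smooth_on_componentwise:
  assumes "open S" "\<And>b. b \<in> Basis \<Longrightarrow> smooth_on (\<lambda>x. f x \<bullet> b) S"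
  shows "smooth_on f S"
proof -
  have "smooth_on (\<lambda>x. \<Sum>b\<in>Basis. (f x \<bullet> b) *\<^sub>R b) S"
    by (intro smooth_intros assms) auto
  then show ?thesis by (simp add: euclidean_representation)
qed

lemma smooth_on_Pair [smooth_intros]:
  assumes "open S" "smooth_on f S" "smooth_on g S"
  shows "smooth_on (\<lambda>x. (f x, g x)) S"
proof (rule smooth_on_componentwise[OF assms(1)])
  fix b :: "'b \<times> 'c"
  have "smooth_on (\<lambda>x. f x \<bullet> fst b + g x \<bullet> snd b) S"
    by (intro smooth_intros assms)
  then show "smooth_on (\<lambda>x. (f x, g x) \<bullet> b) S"
    by (simp add: inner_prod_def)
qed

lemma smooth_on_vec_lambda [smooth_intros]:
  fixes f :: "'i::finite \<Rightarrow> 'a::euclidean_space \<Rightarrow> 'b::euclidean_space"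
  assumes "open S" "\<And>i. smooth_on (f i) S"
  shows "smooth_on (\<lambda>x. \<chi> i. f i x) S"
proof (rule smooth_on_componentwise[OF assms(1)])
  fix b :: "'b ^ 'i"
  have "smooth_on (\<lambda>x. \<Sum>i\<in>UNIV. f i x \<bullet> b $ i) S"
    by (intro smooth_intros assms) auto
  then show "smooth_on (\<lambda>x. (\<chi> i. f i x) \<bullet> b) S"
    by (simp add: inner_vec_def)
qed

text \<open>In one variable a single ordinary derivative carries all directional ones. The equations
  exp' = exp and inverse' = - inverse^2 then close the inductions on the order, and ln' = inverse
  reduces the logarithm to the inverse.\<close>

lemma C_k_on_SucI_real:
  fixes f :: "real \<Rightarrow> real"
  assumes "open S" "\<And>x. x \<in> S \<Longrightarrow> (f has_real_derivative f' x) (at x)" "C_k_on k f' S"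
  shows "C_k_on (Suc k) f S"
proof (rule C_k_on_SucI[OF assms(1)])
  show "(f has_derivative (\<lambda>v. v * f' x)) (at x)" if "x \<in> S" for x
    using assms(2)[OF that] by (simp add: has_field_derivative_def mult_commute_abs)
  show "C_k_on k (\<lambda>x. v * f' x) S" for v
    by (rule C_k_on_bounded_linear[OF assms(1) bounded_linear_mult_right assms(3)])
qed

lemma smooth_on_exp_real: "smooth_on exp (UNIV :: real set)"
proof -
  have "C_k_on k exp (UNIV :: real set)" for k
  proof (induction k)
    case (Suc k)
    show ?case by (rule C_k_on_SucI_real[OF _ _ Suc]) (auto intro: DERIV_exp)
  qed (auto intro!: continuous_intros)
  then show ?thesis by (simp add: smooth_on_def)
qed

lemma smooth_on_inverse_real: "smooth_on inverse (- {0 :: real})"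
proof -
  have "C_k_on k inverse (- {0 :: real})" for k
  proof (induction k)
    case (Suc k)
    show ?case
      by (rule C_k_on_SucI_real[where f' = "\<lambda>x. - (inverse x * inverse x)"])
        (auto intro!: derivative_eq_intros Suc C_k_on_bounded_bilinear[OF _ bounded_bilinear_mult]
          C_k_on_bounded_linear[OF _ bounded_linear_minus[OF bounded_linear_ident]])
  qed (auto intro!: continuous_intros)
  then show ?thesis by (simp add: smooth_on_def)
qed

lemma smooth_on_ln_real: "smooth_on ln {0 :: real<..}"
proof -
  have "C_k_on k ln {0 :: real<..}" for k
  proof (cases k)
    case (Suc m)
    have "C_k_on m inverse {0 :: real<..}"
      using smooth_on_inverse_real by (auto simp: smooth_on_def intro: C_k_on_subset[of _ "- {0}"])
    then show ?thesis unfolding Suc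
      by (rule C_k_on_SucI_real[rotated 2]) (auto intro!: derivative_eq_intros simp: field_simps)
  qed (auto intro!: continuous_intros)
  then show ?thesis by (simp add: smooth_on_def)
qed

lemma smooth_on_exp [smooth_intros]:
  fixes f :: "'a::euclidean_space \<Rightarrow> real"
  shows "open S \<Longrightarrow> smooth_on f S \<Longrightarrow> smooth_on (\<lambda>x. exp (f x)) S"
  by (rule smooth_on_compose[OF smooth_on_exp_real]) auto

lemma smooth_on_ln [smooth_intros]:
  fixes f :: "'a::euclidean_space \<Rightarrow> real"
  shows "open S \<Longrightarrow> smooth_on f S \<Longrightarrow> (\<And>x. x \<in> S \<Longrightarrow> f x > 0) \<Longrightarrow> smooth_on (\<lambda>x. ln (f x)) S"
  by (rule smooth_on_compose[OF smooth_on_ln_real]) auto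

lemma smooth_on_inverse [smooth_intros]:
  fixes f :: "'a::euclidean_space \<Rightarrow> real"
  shows "open S \<Longrightarrow> smooth_on f S \<Longrightarrow> (\<And>x. x \<in> S \<Longrightarrow> f x \<noteq> 0) \<Longrightarrow>
    smooth_on (\<lambda>x. inverse (f x)) S"
  by (rule smooth_on_compose[OF smooth_on_inverse_real]) auto

lemma smooth_on_divide [smooth_intros]:
  fixes f g :: "'a::euclidean_space \<Rightarrow> real"
  assumes "open S" "smooth_on f S" "smooth_on g S" "\<And>x. x \<in> S \<Longrightarrow> g x \<noteq> 0"
  shows "smooth_on (\<lambda>x. f x / g x) S"
  unfolding divide_inverse by (intro smooth_intros assms)

section \<open>Smooth maps on subsets and level sets\<close>

lemma smooth_mapI_open: "open U \<Longrightarrow> M \<subseteq> U \<Longrightarrow> smooth_on f U \<Longrightarrow> smooth_map M f"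
  unfolding smooth_map_def by (intro ballI exI[of _ U] exI[of _ f]) auto

lemma smooth_mapE:
  assumes "smooth_map M f" "p \<in> M"
  obtains U f' where "open U" "p \<in> U" "smooth_on f' U" "\<And>x. x \<in> M \<Longrightarrow> x \<in> U \<Longrightarrow> f x = f' x"
proof -
  from assms have "\<exists>U f'. open U \<and> p \<in> U \<and> smooth_on f' U \<and> (\<forall>x\<in>M \<inter> U. f x = f' x)"
    unfolding smooth_map_def by (rule bspec)
  then show thesis
    by (elim exE conjE) (rule that, assumption+, simp)
qed

lemma smooth_map_compose:
  assumes "smooth_map N g" "smooth_map M f" "f ` M \<subseteq> N"
  shows "smooth_map M (\<lambda>x. g (f x))"
  unfolding smooth_map_def
proof
  fix p assume p: "p \<in> M"
  have fp: "f p \<in> N" using assms(3) p by auto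
  from assms(2) p obtain U f' where U: "open U" "p \<in> U" "smooth_on f' U"
    and f': "\<And>x. x \<in> M \<Longrightarrow> x \<in> U \<Longrightarrow> f x = f' x"
    by (rule smooth_mapE) (rule that, assumption+)
  from assms(1) fp obtain V g' where V: "open V" "f p \<in> V" "smooth_on g' V"
    and g': "\<And>y. y \<in> N \<Longrightarrow> y \<in> V \<Longrightarrow> g y = g' y"
    by (rule smooth_mapE) (rule that, assumption+)
  \<comment> \<open>The extension \<open>f'\<close> may leave \<open>V\<close> away from
    \<open>p\<close>, so its domain is cut down to the preimage of \<open>V\<close>.\<close>
  define W where "W = U \<inter> f' -` V"
  have "open W"
    unfolding W_def
    by (rule continuous_open_preimage[OF smooth_on_imp_continuous_on[OF U(3)] U(1) V(1)])
  moreover have "p \<in> W"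
    using U(2) f'[OF p U(2)] V(2) by (simp add: W_def)
  moreover have "smooth_on (\<lambda>x. g' (f' x)) W"
    by (rule smooth_on_compose[OF V(3) smooth_on_subset[OF U(3)] \<open>open W\<close> V(1)])
      (auto simp: W_def)
  moreover have "g (f x) = g' (f' x)" if "x \<in> M \<inter> W" for x
  proof -
    have "f x = f' x" using that f' by (simp add: W_def)
    moreover have "f x \<in> N" using that assms(3) by auto
    moreover have "f x \<in> V" using that \<open>f x = f' x\<close> by (simp add: W_def)
    ultimately show ?thesis using g'[of "f x"] by simp
  qed
  ultimately show "\<exists>U h. open U \<and> p \<in> U \<and> smooth_on h U \<and> (\<forall>x\<in>M \<inter> U. g (f x) = h x)"
    by (intro exI[of _ W] exI[of _ "\<lambda>x. g' (f' x)"]) simp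
qed

lemma smooth_map_Pair:
  assumes "smooth_map M f" "smooth_map M g"
  shows "smooth_map M (\<lambda>x. (f x, g x))"
  unfolding smooth_map_def
proof
  fix p assume p: "p \<in> M"
  from assms(1) p obtain U f' where U: "open U" "p \<in> U" "smooth_on f' U"
    and f': "\<And>x. x \<in> M \<Longrightarrow> x \<in> U \<Longrightarrow> f x = f' x"
    by (rule smooth_mapE) (rule that, assumption+)
  from assms(2) p obtain V g' where V: "open V" "p \<in> V" "smooth_on g' V"
    and g': "\<And>y. y \<in> M \<Longrightarrow> y \<in> V \<Longrightarrow> g y = g' y"
    by (rule smooth_mapE) (rule that, assumption+)
  have "smooth_on (\<lambda>x. (f' x, g' x)) (U \<inter> V)"
    using U(1) V(1) smooth_on_subset[OF U(3), of "U \<inter> V"] smooth_on_subset[OF V(3), of "U \<inter> V"]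
    by (intro smooth_on_Pair) auto
  then show "\<exists>U h. open U \<and> p \<in> U \<and> smooth_on h U \<and> (\<forall>x\<in>M \<inter> U. (f x, g x) = h x)"
    using U V f' g' by (intro exI[of _ "U \<inter> V"] exI[of _ "\<lambda>x. (f' x, g' x)"]) auto
qed

lemma smooth_map_id: "smooth_map M (\<lambda>x. x)"
  by (rule smooth_mapI_open[of UNIV]) (auto intro: smooth_intros)

text \<open>The function is the composite of \<open>p \<mapsto> (p, X p, Y p)\<close> with
  \<open>g\<close> as a function of three arguments. It is therefore enough that \<open>g\<close> be
  smooth in all ambient vectors, tangent or not.\<close>

lemma smooth_map_metric:
  assumes "open U" "M \<subseteq> U" "smooth_on (\<lambda>(p, v, w). g p v w) (U \<times> UNIV \<times> UNIV)"
    and "smooth_map M X" "smooth_map M Y"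
  shows "smooth_map M (\<lambda>p. g p (X p) (Y p))"
proof -
  have "smooth_map (U \<times> UNIV \<times> UNIV) (\<lambda>(p, v, w). g p v w)"
    by (rule smooth_mapI_open[OF _ order_refl assms(3)]) (simp add: assms(1) open_Times)
  from smooth_map_compose[OF this smooth_map_Pair[OF smooth_map_id smooth_map_Pair[OF assms(4,5)]]]
  show ?thesis using assms(2) by auto
qed

section \<open>Diffeomorphisms and straightening charts\<close>

lemma diffeomorphismI:
  assumes "smooth_map M F" "smooth_map N G"
    and "\<And>x. x \<in> M \<Longrightarrow> F x \<in> N \<and> G (F x) = x" "\<And>y. y \<in> N \<Longrightarrow> G y \<in> M \<and> F (G y) = y"
  shows "diffeomorphism M N F G"
  unfolding diffeomorphism_def
proof (intro conjI)
  show "F ` M = N"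
    using assms(3,4) by (force intro: image_eqI[of _ F "G _"])
  show "G ` N = M"
    using assms(3,4) by (force intro: image_eqI[of _ G "F _"])
qed (use assms in auto)

lemma embedded_submanifold_open:
  fixes M :: "'a::euclidean_space set"
  assumes "open M"
  shows "embedded_submanifold DIM('a) M"
  unfolding embedded_submanifold_def
proof
  fix p assume p: "p \<in> M"
  have "diffeomorphism M M (\<lambda>x. x) (\<lambda>x. x)"
    by (rule diffeomorphismI) (auto intro: smooth_map_id)
  then show "\<exists>U V \<phi> \<psi> L. open U \<and> p \<in> U \<and> open V \<and> diffeomorphism U (V::'a set) \<phi> \<psi> \<and>
      subspace L \<and> dim L = DIM('a) \<and> \<phi> ` (M \<inter> U) = V \<inter> L"
    using p assms by (intro exI[of _ M] exI[of _ "\<lambda>x. x"] exI[of _ UNIV]) auto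
qed

text \<open>Where \<open>f\<close> is affine along a direction \<open>e\<close> with nonzero slope, replacing the \<open>e\<close>-coordinate of
  a point by the value of \<open>f\<close> is a straightening chart with an explicit inverse, so the inverse
  function theorem is not needed.\<close>

lemma embedded_submanifold_level_set:
  fixes f :: "'a::euclidean_space \<Rightarrow> real"
  assumes smooth: "smooth_on f UNIV"
    and affine: "\<And>p. f p = 0 \<Longrightarrow> \<exists>e. norm e = 1 \<and> f (p + e) \<noteq> f p \<and>
      (\<forall>x t. f (x + t *\<^sub>R e) = f x + t * (f (x + e) - f x))"
  shows "embedded_submanifold (DIM('a) - 1) {x. f x = 0}"
  unfolding embedded_submanifold_def
proof
  fix p assume "p \<in> {x. f x = 0}"
  then obtain e where e: "norm e = 1" "f (p + e) \<noteq> f p"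
    and aff: "\<And>x t. f (x + t *\<^sub>R e) = f x + t * (f (x + e) - f x)"
    using affine by blast
  have ee: "e \<bullet> e = 1" using e(1) by (simp add: dot_square_norm)
  define c where "c x = f (x + e) - f x" for x
  have aff': "f (x + t *\<^sub>R e) = f x + t * c x" for x t
    using aff by (simp add: c_def)
  have c: "c (x + t *\<^sub>R e) = c x" for x t
  proof -
    have "c (x + t *\<^sub>R e) = f (x + (t + 1) *\<^sub>R e) - f (x + t *\<^sub>R e)"
      by (simp add: c_def algebra_simps)
    then show ?thesis unfolding aff' by (simp add: algebra_simps)
  qed
  \<comment> \<open>Both \<open>\<phi>\<close> and \<open>\<psi>\<close> move points along
    \<open>e\<close> only, and the slope \<open>c\<close> is constant in that direction; hence each
    maps \<open>U\<close> into itself.\<close>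
  define U where "U = {x. c x \<noteq> 0}"
  define \<phi> where "\<phi> x = x + (f x - e \<bullet> x) *\<^sub>R e" for x
  \<comment> \<open>The coefficient of \<open>e\<close> is the solution \<open>t\<close> of the
    linear equation f (y + t e) = f y + t c(y) = e \<bullet> y.\<close>
  define \<psi> where "\<psi> y = y + ((e \<bullet> y - f y) / c y) *\<^sub>R e" for y
  have fe: "smooth_on (\<lambda>x. f (x + e)) UNIV"
    by (rule smooth_on_compose[OF smooth]) (auto intro!: smooth_intros)
  have sc: "smooth_on c UNIV"
    unfolding c_def by (intro smooth_intros fe smooth open_UNIV)
  have "open U"
    unfolding U_def using smooth_on_imp_continuous_on[OF sc]
    by (intro open_Collect_neq continuous_on_const)
  have s\<phi>: "smooth_on \<phi> UNIV"
    unfolding \<phi>_def by (intro smooth_intros smooth open_UNIV)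
  have "smooth_on f U" "smooth_on c U"
    by (rule smooth_on_subset[OF smooth subset_UNIV], rule smooth_on_subset[OF sc subset_UNIV])
  then have s\<psi>: "smooth_on \<psi> U"
    unfolding \<psi>_def by (intro smooth_intros \<open>open U\<close>) (auto simp: U_def)
  have \<phi>: "\<phi> x \<in> U \<and> \<psi> (\<phi> x) = x \<and> e \<bullet> \<phi> x = f x" if "x \<in> U" for x
  proof -
    have "c (\<phi> x) = c x" "f (\<phi> x) = f x + (f x - e \<bullet> x) * c x" and e\<phi>: "e \<bullet> \<phi> x = f x"
      by (simp_all add: \<phi>_def c aff' ee inner_add_right)
    then have "\<phi> x \<in> U" "\<psi> (\<phi> x) = \<phi> x - (f x - e \<bullet> x) *\<^sub>R e"
      using that by (simp_all add: U_def \<psi>_def flip: scaleR_minus_left)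
    with e\<phi> show ?thesis by (simp add: \<phi>_def)
  qed
  have f\<psi>: "f (\<psi> y) = e \<bullet> y" if "y \<in> U" for y
    using that by (simp add: U_def \<psi>_def aff')
  have \<psi>: "\<psi> y \<in> U \<and> \<phi> (\<psi> y) = y" if "y \<in> U" for y
    using that by (simp add: U_def \<phi>_def \<psi>_def c aff' ee inner_add_right)
  have "diffeomorphism U U \<phi> \<psi>"
  proof (rule diffeomorphismI)
    show "smooth_map U \<phi>" by (rule smooth_mapI_open[OF open_UNIV subset_UNIV s\<phi>])
    show "smooth_map U \<psi>" by (rule smooth_mapI_open[OF \<open>open U\<close> order_refl s\<psi>])
  qed (simp_all add: \<phi> \<psi>)
  moreover have "\<phi> ` ({x. f x = 0} \<inter> U) = U \<inter> {y. e \<bullet> y = 0}"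
  proof (intro equalityI subsetI)
    fix y assume y: "y \<in> U \<inter> {y. e \<bullet> y = 0}"
    then show "y \<in> \<phi> ` ({x. f x = 0} \<inter> U)"
      using f\<psi>[of y] \<psi>[of y] by (intro image_eqI[of _ _ "\<psi> y"]) auto
  qed (auto simp: \<phi>)
  moreover have "dim {y. e \<bullet> y = 0} = DIM('a) - 1"
    using e(1) by (intro dim_hyperplane) auto
  moreover have "p \<in> U" using e(2) by (simp add: U_def c_def)
  ultimately show "\<exists>U V \<phi> \<psi> L. open U \<and> p \<in> U \<and> open V \<and> diffeomorphism U (V::'a set) \<phi> \<psi> \<and>
      subspace L \<and> dim L = DIM('a) - 1 \<and> \<phi> ` ({x. f x = 0} \<inter> U) = V \<inter> L"
    using \<open>open U\<close> subspace_hyperplane[of e]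
    by (intro exI[of _ U] exI[of _ \<phi>] exI[of _ \<psi>] exI[of _ "{y. e \<bullet> y = 0}"] conjI)
qed

section \<open>Tangent spaces and differentials\<close>

lemma has_vector_derivative_line: "((\<lambda>t. p + t *\<^sub>R v) has_vector_derivative v) (at (0::real))"
  by (auto intro!: derivative_eq_intros simp: has_vector_derivative_def)

text \<open>The curve is the image under \<open>R\<close> of the line through \<open>p\<close> with direction \<open>v\<close>.\<close>

lemma tangent_spaceI:
  assumes "open U" "p \<in> U" "smooth_on R U" "R ` U \<subseteq> M" "R p = p" "(R has_derivative D) (at p)" "D v = v"
  shows "v \<in> tangent_space M p"
proof -
  let ?\<gamma> = "\<lambda>t::real. p + t *\<^sub>R v"
  have "continuous_on UNIV ?\<gamma>" by (intro continuous_intros)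
  then have "open (?\<gamma> -` U)" using assms(1) by (rule open_vimage[rotated])
  moreover have "0 \<in> ?\<gamma> -` U" using assms(2) by simp
  ultimately obtain e where e: "e > 0" "ball 0 e \<subseteq> ?\<gamma> -` U"
    using openE by metis
  have ball: "{-e<..<e} = ball (0::real) e" by (auto simp: dist_real_def)
  have "smooth_on (\<lambda>t. R (?\<gamma> t)) {-e<..<e}"
    by (rule smooth_on_compose[OF assms(3)]) (use e(2) assms(1) in \<open>auto simp: ball intro!: smooth_intros\<close>)
  moreover have "(\<lambda>t. R (?\<gamma> t)) ` {-e<..<e} \<subseteq> M"
    using e(2) assms(4) unfolding ball by auto
  moreover have "((\<lambda>t. R (?\<gamma> t)) has_vector_derivative v) (at 0)"
  proof -
    have "(R has_derivative D) (at (?\<gamma> 0))" using assms(6) by simp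
    from has_derivative_compose[OF has_vector_derivative_line[unfolded has_vector_derivative_def] this]
    have "((\<lambda>t. R (?\<gamma> t)) has_derivative (\<lambda>t. D (t *\<^sub>R v))) (at 0)" .
    then show ?thesis
      using linear_cmul[OF has_derivative_linear[OF assms(6)]] assms(7)
      by (simp add: has_vector_derivative_def)
  qed
  ultimately show ?thesis
    using e(1) assms(5) unfolding tangent_space_def curve_at_def
    by (intro CollectI exI[of _ "\<lambda>t. R (?\<gamma> t)"]) auto
qed

lemma tangent_space_open: "open M \<Longrightarrow> p \<in> M \<Longrightarrow> tangent_space M p = UNIV"
  using tangent_spaceI[of M p "\<lambda>x. x" M "\<lambda>v. v"] by (auto intro: smooth_on_id)

text \<open>\<open>F\<close> need not be differentiable off \<open>M\<close>, so the chain rule is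
  applied to the local extension \<open>F'\<close>. By continuity the curve stays in
  \<open>U\<close> for small times, where \<open>F\<close> and \<open>F'\<close> agree along
  it.\<close>

lemma has_vector_derivative_along_curve:
  fixes M :: "'a::euclidean_space set" and F :: "'a \<Rightarrow> 'b::real_normed_vector"
  assumes \<gamma>: "curve_at M p v \<gamma>"
    and F: "(F' has_derivative D) (at p)" "open U" "p \<in> U" "\<And>x. x \<in> M \<inter> U \<Longrightarrow> F x = F' x"
  shows "(F \<circ> \<gamma> has_vector_derivative D v) (at 0)"
proof -
  obtain e where e: "e > 0" "\<gamma> ` {-e<..<e} \<subseteq> M" "smooth_on \<gamma> {-e<..<e}"
    using \<gamma> unfolding curve_at_def by blast
  have 0: "\<gamma> 0 = p" and d: "(\<gamma> has_derivative (\<lambda>t. t *\<^sub>R v)) (at 0)"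
    using \<gamma> by (auto simp: curve_at_def has_vector_derivative_def)
  have F': "(F' has_derivative D) (at (\<gamma> 0))"
    using F(1) 0 by simp
  have "((\<lambda>t. F' (\<gamma> t)) has_derivative (\<lambda>t. D (t *\<^sub>R v))) (at 0)"
    by (rule has_derivative_compose[OF d F'])
  then have "((\<lambda>t. F' (\<gamma> t)) has_vector_derivative D v) (at 0)"
    using linear_cmul[OF has_derivative_linear[OF F(1)]] by (simp add: has_vector_derivative_def)
  moreover have "open ({-e<..<e} \<inter> \<gamma> -` U)"
    using smooth_on_imp_continuous_on[OF e(3)] F(2)
    by (intro continuous_open_preimage) auto
  ultimately show ?thesis
    by (rule has_vector_derivative_transform_within_open[where S = "{-e<..<e} \<inter> \<gamma> -` U"])
      (use e(1,2) F(3) 0 F(4) in \<open>auto simp: image_subset_iff\<close>)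
qed

text \<open>Along a curve in \<open>M\<close> the function \<open>f\<close> is constant. In the
  chain rule the constant \<open>c\<close> takes the place of \<open>F\<close> and \<open>f\<close>
  that of its extension, so \<open>D v\<close> is the derivative of a constant.\<close>

lemma tangent_space_level_set_subset:
  fixes f :: "'a::euclidean_space \<Rightarrow> real"
  assumes "v \<in> tangent_space M p" "(f has_derivative D) (at p)" "\<And>x. x \<in> M \<Longrightarrow> f x = c"
  shows "D v = 0"
proof -
  obtain \<gamma> where \<gamma>: "curve_at M p v \<gamma>"
    using assms(1) by (auto simp: tangent_space_def)
  have "((\<lambda>x. c) \<circ> \<gamma> has_vector_derivative D v) (at 0)"
    by (rule has_vector_derivative_along_curve[OF \<gamma> assms(2) open_UNIV]) (auto simp: assms(3))
  then show ?thesis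
    using vector_derivative_unique_at[of "\<lambda>t. c" "D v" 0 0] by (simp add: comp_def)
qed

text \<open>This makes the definite description in \<open>differential\<close> meaningful: tangency
  of \<open>v\<close> supplies a curve, and the chain rule yields the same value \<open>D v\<close>
  for every curve with velocity \<open>v\<close>.\<close>

lemma differential_eq:
  assumes "v \<in> tangent_space M p"
    and "(F' has_derivative D) (at p)" "open U" "p \<in> U" "\<And>x. x \<in> M \<inter> U \<Longrightarrow> F x = F' x"
  shows "differential M F p v = D v"
  unfolding differential_def
proof (rule the_equality)
  show "\<exists>\<gamma>. curve_at M p v \<gamma> \<and> (F \<circ> \<gamma> has_vector_derivative D v) (at 0)"
    using assms(1) has_vector_derivative_along_curve[OF _ assms(2-5)]
    by (auto simp: tangent_space_def)
  show "w = D v" if "\<exists>\<gamma>. curve_at M p v \<gamma> \<and> (F \<circ> \<gamma> has_vector_derivative w) (at 0)" for w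
  proof -
    from that obtain \<gamma> where "curve_at M p v \<gamma>" "(F \<circ> \<gamma> has_vector_derivative w) (at 0)" by blast
    with has_vector_derivative_along_curve[OF this(1) assms(2-5)] show ?thesis
      using vector_derivative_unique_at by metis
  qed
qed

text \<open>Images and preimages under \<open>L\<close> carry negative definite subspaces to
  negative definite subspaces of the same dimension. Both sets of dimensions are thus equal, and so
  are their maxima.\<close>

lemma index_on_linear_iso:
  fixes L :: "'a::euclidean_space \<Rightarrow> 'a"
  assumes L: "linear L" "inj L" "L ` T = T'"
    and b: "\<And>v. v \<in> T \<Longrightarrow> b v v = b' (L v) (L v)"
  shows "index_on T b = index_on T' b'"
proof -
  have "{dim W | W. subspace W \<and> W \<subseteq> T \<and> (\<forall>w\<in>W. w \<noteq> 0 \<longrightarrow> b w w < 0)} =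
    {dim W | W. subspace W \<and> W \<subseteq> T' \<and> (\<forall>w\<in>W. w \<noteq> 0 \<longrightarrow> b' w w < 0)}" (is "?A = ?B")
  proof (intro equalityI subsetI)
    fix d assume "d \<in> ?A"
    then obtain W where W: "d = dim W" "subspace W" "W \<subseteq> T" "\<forall>w\<in>W. w \<noteq> 0 \<longrightarrow> b w w < 0" by blast
    have "dim (L ` W) = dim W"
      using L(1,2) by (intro dim_image_eq) (auto intro: inj_on_subset)
    moreover have "subspace (L ` W)" using L(1) W(2) by (rule linear_subspace_image)
    moreover have "b' u u < 0" if "u \<in> L ` W" "u \<noteq> 0" for u
      using that W(3,4) b linear_0[OF L(1)] by force
    ultimately show "d \<in> ?B" using W(1,3) L(3) by (intro CollectI exI[of _ "L ` W"]) auto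
  next
    fix d assume "d \<in> ?B"
    then obtain W where W: "d = dim W" "subspace W" "W \<subseteq> T'" "\<forall>w\<in>W. w \<noteq> 0 \<longrightarrow> b' w w < 0" by blast
    \<comment> \<open>An injective endomorphism of the finite-dimensional ambient space is onto, so
      the image of the preimage of \<open>W\<close> is \<open>W\<close> itself.\<close>
    have surj: "surj L" using L(1,2) by (simp add: linear_injective_imp_surjective)
    have "dim (L ` (L -` W)) = dim (L -` W)"
      using L(1,2) by (intro dim_image_eq) (auto intro: inj_on_subset)
    then have "dim (L -` W) = dim W" by (simp add: surj surj_image_vimage_eq)
    moreover have "subspace (L -` W)" using L(1) W(2) by (rule linear_subspace_vimage)
    moreover have sub: "L -` W \<subseteq> T"
      using W(3) L(2,3) by (auto simp: inj_def)
    moreover have "b u u < 0" if "u \<in> L -` W" "u \<noteq> 0" for u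
    proof -
      have "L u \<noteq> 0" using that(2) L(1,2) by (auto simp: linear_injective_0)
      then show ?thesis using that sub W(4) b by auto
    qed
    ultimately show "d \<in> ?A" using W(1) by (intro CollectI exI[of _ "L -` W"]) auto
  qed
  then show ?thesis by (simp add: index_on_def)
qed

section \<open>Matrix calculus\<close>

lemma matrix_inv_right: "invertible A \<Longrightarrow> A ** matrix_inv A = mat 1"
  and matrix_inv_left: "invertible A \<Longrightarrow> matrix_inv A ** A = mat 1"
  unfolding invertible_def matrix_inv_def by (metis (mono_tags, lifting) someI_ex)+

lemma matrix_inv_eqI:
  fixes A :: "real^'n^'n"
  assumes "A ** B = mat 1"
  shows "matrix_inv A = B"
proof -
  have inv: "invertible A" using assms invertible_right_inverse by blast
  have "matrix_inv A = matrix_inv A ** (A ** B)" by (simp add: assms)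
  also have "\<dots> = B" by (simp add: matrix_mul_assoc matrix_inv_left[OF inv])
  finally show ?thesis .
qed

text \<open>Column \<open>l\<close> of the inverse solves A x = \<open>axis l 1\<close>, so Cramer's
  rule applies. The point is to have the entries as quotients of polynomials, from which smoothness
  of the inversion follows.\<close>

lemma matrix_inv_cramer:
  fixes A :: "real^'n^'n"
  assumes "invertible A"
  shows "matrix_inv A =
    (\<chi> k l. det (\<chi> i j. if j = k then axis l 1 $ i else A $ i $ j) / det A)"
proof -
  have "matrix_inv A $ k $ l = det (\<chi> i j. if j = k then axis l 1 $ i else A $ i $ j) / det A" for k l
  proof -
    have "A *v (matrix_inv A *v axis l 1) = axis l 1"
      by (simp add: matrix_vector_mul_assoc matrix_inv_right[OF assms])
    then have "matrix_inv A *v axis l 1 =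
        (\<chi> k. det (\<chi> i j. if j = k then axis l 1 $ i else A $ i $ j) / det A)"
      using cramer[of A] assms by (simp add: invertible_det_nz)
    moreover have "(matrix_inv A *v axis l 1) $ k = matrix_inv A $ k $ l"
      by (simp add: matrix_vector_mult_basis column_def)
    ultimately show ?thesis by simp
  qed
  then show ?thesis by (simp add: vec_eq_iff)
qed

section \<open>Smoothness of the matrix operations\<close>

lemma smooth_on_det [smooth_intros]:
  fixes f :: "'a::euclidean_space \<Rightarrow> real^'n^'n"
  assumes "open S" "smooth_on f S"
  shows "smooth_on (\<lambda>x. det (f x)) S"
  unfolding det_def by (intro smooth_intros assms) (auto simp: finite_permutations)

lemma smooth_on_matrix_mult [smooth_intros]:
  fixes f g :: "'a::euclidean_space \<Rightarrow> real^'n^'n"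
  assumes "open S" "smooth_on f S" "smooth_on g S"
  shows "smooth_on (\<lambda>x. f x ** g x) S"
  unfolding matrix_matrix_mult_def by (intro smooth_intros assms) auto

lemma smooth_on_trace [smooth_intros]:
  fixes f :: "'a::euclidean_space \<Rightarrow> real^'n^'n"
  assumes "open S" "smooth_on f S"
  shows "smooth_on (\<lambda>x. trace (f x)) S"
  unfolding trace_def by (intro smooth_intros assms) auto

lemma smooth_on_matrix_inv [smooth_intros]:
  fixes f :: "'a::euclidean_space \<Rightarrow> real^'n^'n"
  assumes S: "open S" and f: "smooth_on f S" and inv: "\<And>x. x \<in> S \<Longrightarrow> invertible (f x)"
  shows "smooth_on (\<lambda>x. matrix_inv (f x)) S"
proof -
  have c: "smooth_on (\<lambda>x. if j = k then axis l 1 $ i else f x $ i $ j) S" for i j k l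
    by (cases "j = k") (auto intro!: smooth_intros S f)
  have "smooth_on (\<lambda>x. \<chi> k l. det (\<chi> i j. if j = k then axis l 1 $ i else f x $ i $ j) / det (f x)) S"
    by (intro smooth_intros c S f) (use inv in \<open>simp add: invertible_det_nz\<close>)
  then show ?thesis
    by (subst smooth_on_cong[OF S matrix_inv_cramer[OF inv]]) simp_all
qed

section \<open>Algebra of matrix products, traces and determinants\<close>

lemma linear_matrix_mult_right: "linear (\<lambda>X :: real^'n^'n. B ** X)" for B :: "real^'n^'n"
  by (rule linearI) (simp_all add: matrix_add_ldistrib matrix_scalar_ac scalar_matrix_assoc)

lemma matrix_mult_diff_distrib:
  fixes A B C :: "real^'n^'n"
  shows "A ** (B - C) = A ** B - A ** C" "(A - B) ** C = A ** C - B ** C"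
  by (simp_all add: vec_eq_iff matrix_matrix_mult_def algebra_simps sum_subtractf)

lemma matrix_add_rdistrib: "(A + B) ** C = A ** C + B ** C" for A B C :: "real^'n^'n"
  by (simp add: vec_eq_iff matrix_matrix_mult_def algebra_simps sum.distrib)

lemma trace_scaleR: "trace (c *\<^sub>R A) = c * trace A" for A :: "real^'n^'n"
  by (simp add: trace_def sum_distrib_left)

lemma trace_transpose: "trace (transpose A) = trace A"
  by (simp add: trace_def transpose_def)

lemma trace_mult_transpose: "trace (A ** transpose A) = A \<bullet> A" for A :: "real^'n^'n"
  by (simp add: trace_def matrix_matrix_mult_def transpose_def inner_vec_def)

lemma det_scaleR: "det (c *\<^sub>R A) = c ^ CARD('n) * det A" for A :: "real^'n^'n"
  using det_rows_mul[of "\<lambda>_. c" "\<lambda>i. A $ i"]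
  by (simp add: scalar_mult_eq_scaleR prod_constant vec_lambda_eta scaleR_vec_def)

text \<open>Linearity in row \<open>i\<close>; the coefficient of \<open>t\<close> is the cofactor
  of the entry (i, j), written as the determinant with row \<open>i\<close> replaced by a unit
  vector.\<close>

lemma det_add_entry:
  fixes A :: "real^'n^'n"
  shows "det (A + t *\<^sub>R axis i (axis j 1)) =
    det A + t * det (\<chi> k. if k = i then axis j 1 else A $ k)"
proof -
  have "A + t *\<^sub>R axis i (axis j 1) = (\<chi> k. if k = i then A $ k + t *s axis j 1 else A $ k)"
    by (auto simp: vec_eq_iff axis_def)
  moreover have "A = (\<chi> k. if k = i then A $ k else A $ k)"
    by (simp add: vec_eq_iff)
  ultimately show ?thesis
    by (simp add: det_row_add det_row_mul)
qed

text \<open>Laplace expansion from linearity in row \<open>i\<close>, with cofactors in the same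
  form as above. It is used to find a nonzero cofactor when the determinant does not vanish.\<close>

lemma det_expand_row:
  fixes A :: "real^'n^'n"
  shows "det A = (\<Sum>j\<in>UNIV. A $ i $ j * det (\<chi> k. if k = i then axis j 1 else A $ k))"
proof -
  have "A = (\<chi> k. if k = i then (\<Sum>j\<in>UNIV. A $ k $ j *s axis j 1) else A $ k)"
    by (simp add: vec_eq_iff basis_expansion)
  then have "det A = det (\<chi> k. if k = i then (\<Sum>j\<in>UNIV. A $ k $ j *s axis j 1) else A $ k)"
    by simp
  also have "\<dots> = (\<Sum>j\<in>UNIV. det (\<chi> k. if k = i then A $ k $ j *s axis j 1 else A $ k))"
    by (rule det_linear_row_sum) simp
  also have "\<dots> = (\<Sum>j\<in>UNIV. A $ i $ j * det (\<chi> k. if k = i then axis j 1 else A $ k))"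
  proof (rule sum.cong[OF refl])
    fix j
    have "(\<chi> k. if k = i then A $ k $ j *s axis j 1 else A $ k) =
        (\<chi> k. if k = i then A $ i $ j *s axis j 1 else A $ k)"
      by (simp add: vec_eq_iff)
    then show "det (\<chi> k. if k = i then A $ k $ j *s axis j 1 else A $ k) =
        A $ i $ j * det (\<chi> k. if k = i then axis j 1 else A $ k)"
      by (simp add: det_row_mul)
  qed
  finally show ?thesis .
qed

text \<open>In the Leibniz formula a permutation other than \<open>id\<close> moves at least two
  points. After one factor has been differentiated, an off-diagonal entry of the identity matrix, a
  zero, is left in the product; only \<open>id\<close> contributes, and its term is the
  trace.\<close>

lemma has_derivative_det_mat_1: "(det has_derivative trace) (at (mat 1 :: real^'n^'n))"
proof -
  let ?P = "{p. p permutes (UNIV :: 'n set)}"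
  let ?q = "\<lambda>i p. \<Prod>j\<in>UNIV - {i}. (mat 1 :: real^'n^'n) $ j $ p j"
  have entry: "((\<lambda>A :: real^'n^'n. A $ i $ j) has_derivative (\<lambda>V. V $ i $ j)) F" for i j F
    by (intro bounded_linear_imp_has_derivative bounded_linear_compose[OF bounded_linear_vec_nth]
        bounded_linear_vec_nth)
  have "((\<lambda>A :: real^'n^'n. \<Sum>p\<in>?P. of_int (sign p) * (\<Prod>i\<in>UNIV. A $ i $ p i)) has_derivative
      (\<lambda>V. \<Sum>p\<in>?P. of_int (sign p) * (\<Sum>i\<in>UNIV. V $ i $ p i * ?q i p))) (at (mat 1))"
    by (intro has_derivative_sum has_derivative_mult_right has_derivative_prod entry)
  moreover have "(\<Sum>p\<in>?P. of_int (sign p) * (\<Sum>i\<in>UNIV. V $ i $ p i * ?q i p)) = trace V"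
    for V :: "real^'n^'n"
  proof -
    have "of_int (sign p) * (\<Sum>i\<in>UNIV. V $ i $ p i * ?q i p) = (if p = id then trace V else 0)"
      if p: "p \<in> ?P" for p
    proof (cases "p = id")
      case True
      then show ?thesis by (simp add: mat_def trace_def)
    next
      case False
      have q: "?q i p = 0" for i
      proof -
        \<comment> \<open>If \<open>i\<close> were the only point moved, \<open>p i\<close> would be
          fixed, and injectivity would force \<open>p i = i\<close>.\<close>
        have "\<exists>j. j \<noteq> i \<and> p j \<noteq> j"
        proof (rule ccontr)
          assume *: "\<not> ?thesis"
          have "p i = i"
          proof (rule ccontr)
            assume ne: "p i \<noteq> i"
            with * have "p (p i) = p i" by blast
            then show False using ne permutes_inj[of p UNIV] p by (auto dest: injD)
          qed
          then show False using * False by (metis eq_id_iff)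
        qed
        then obtain j where "j \<noteq> i" "p j \<noteq> j" by blast
        then show ?thesis by (intro prod_zero) (auto simp: mat_def intro!: bexI[of _ j])
      qed
      have "(\<Sum>i\<in>UNIV. V $ i $ p i * ?q i p) = 0"
        by (simp only: q mult_zero_right sum.neutral_const)
      with False show ?thesis by (simp only: if_False mult_zero_right)
    qed
    then have "(\<Sum>p\<in>?P. of_int (sign p) * (\<Sum>i\<in>UNIV. V $ i $ p i * ?q i p)) =
        (\<Sum>p\<in>?P. if p = id then trace V else 0)"
      by (rule sum.cong[OF refl])
    also have "\<dots> = trace V"
      by (simp add: finite_permutations)
    finally show ?thesis .
  qed
  ultimately show ?thesis by (simp add: det_def[abs_def])
qed

text \<open>Jacobi's formula, by left translation to the identity: det X = det A * det (A^-1
  X).\<close>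

lemma has_derivative_det:
  fixes A :: "real^'n^'n"
  assumes "invertible A"
  shows "(det has_derivative (\<lambda>V. det A * trace (matrix_inv A ** V))) (at A)"
proof -
  let ?B = "matrix_inv A"
  have lin: "((\<lambda>X. ?B ** X) has_derivative (\<lambda>V. ?B ** V)) (at A)"
    using linear_matrix_mult_right[of ?B]
    by (intro bounded_linear_imp_has_derivative linear_conv_bounded_linear[THEN iffD1])
  have "(det has_derivative trace) (at (?B ** A))"
    by (simp add: matrix_inv_left[OF assms] has_derivative_det_mat_1)
  from has_derivative_mult_right[OF has_derivative_compose[OF lin this], of "det A"]
  have "((\<lambda>X. det A * det (?B ** X)) has_derivative (\<lambda>V. det A * trace (?B ** V))) (at A)" .
  moreover have "det A * det (?B ** X) = det X" for X
    by (metis assms det_mul matrix_inv_right matrix_mul_assoc matrix_mul_lid)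
  ultimately show ?thesis by simp
qed

section \<open>The trace metric on open subsets of the general linear group\<close>

abbreviation trace_form :: "real^'n^'n \<Rightarrow> real^'n^'n \<Rightarrow> real" where
  "trace_form X Y \<equiv> trace (X ** Y)"

lemma trace_metric_eq: "trace_metric A V W = trace_form (matrix_inv A ** V) (matrix_inv A ** W)"
  by (simp add: trace_metric_def matrix_mul_assoc)

lemma symmetric_bilinear_on_trace_metric: "symmetric_bilinear_on T (trace_metric A)"
  unfolding symmetric_bilinear_on_def trace_metric_eq
  by (auto simp: trace_mul_sym[of "matrix_inv A ** _" "matrix_inv A ** _"] matrix_add_ldistrib matrix_add_rdistrib trace_add
      trace_scaleR matrix_scalar_ac simp flip: scalar_matrix_assoc)

text \<open>\<open>W\<close> is chosen so that A^-1 W is the transpose of X = A^-1 V; then tr (X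
  X^T) is the squared Frobenius norm of X. The second claim keeps \<open>W\<close> inside the
  trace-free tangent space whenever \<open>V\<close> lies there.\<close>

lemma trace_metric_witness:
  fixes A V :: "real^'n^'n"
  assumes "invertible A"
  defines "W \<equiv> A ** transpose (matrix_inv A ** V)"
  shows "trace_metric A V W = (matrix_inv A ** V) \<bullet> (matrix_inv A ** V)"
    and "trace (matrix_inv A ** W) = trace (matrix_inv A ** V)"
proof -
  have "matrix_inv A ** W = transpose (matrix_inv A ** V)"
    by (simp add: W_def matrix_mul_assoc matrix_inv_left[OF assms(1)])
  then show "trace_metric A V W = (matrix_inv A ** V) \<bullet> (matrix_inv A ** V)"
    and "trace (matrix_inv A ** W) = trace (matrix_inv A ** V)"
    by (simp_all add: trace_metric_eq trace_mult_transpose trace_transpose)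
qed

lemma matrix_inv_mult_eq_0_iff: "invertible A \<Longrightarrow> matrix_inv A ** V = 0 \<longleftrightarrow> V = 0"
  for A V :: "real^'n^'n"
proof
  assume A: "invertible A" and "matrix_inv A ** V = 0"
  then have "A ** (matrix_inv A ** V) = 0"
    using linear_0[OF linear_matrix_mult_right] by simp
  then show "V = 0" by (simp add: matrix_mul_assoc matrix_inv_right[OF A])
qed (use linear_0[OF linear_matrix_mult_right] in simp)

lemma inj_matrix_inv_mult: "invertible A \<Longrightarrow> inj (\<lambda>V :: real^'n^'n. matrix_inv A ** V)" for A :: "real^'n^'n"
  by (auto simp: linear_injective_0[OF linear_matrix_mult_right] matrix_inv_mult_eq_0_iff)

text \<open>The predicate \<open>P\<close> covers both kinds of tangent space: it is constantly true
  for open sets of matrices and \<open>trace X = 0\<close> for \<open>SL\<close>.\<close>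

lemma matrix_inv_mult_image:
  fixes A :: "real^'n^'n"
  assumes "invertible A"
  shows "(\<lambda>V. matrix_inv A ** V) ` {V. P (matrix_inv A ** V)} = {X. P X}"
proof (intro equalityI subsetI)
  fix X assume "X \<in> {X. P X}"
  moreover have "matrix_inv A ** (A ** X) = X"
    by (simp add: matrix_mul_assoc matrix_inv_left[OF assms])
  ultimately show "X \<in> (\<lambda>V. matrix_inv A ** V) ` {V. P (matrix_inv A ** V)}"
    by (intro image_eqI[of _ _ "A ** X"]) auto
qed auto

lemma nondegenerate_on_trace_metric:
  fixes A :: "real^'n^'n"
  assumes "invertible A" "T = UNIV \<or> T = {V. trace (matrix_inv A ** V) = 0}"
  shows "nondegenerate_on T (trace_metric A)"
  unfolding nondegenerate_on_def
proof (intro ballI impI)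
  fix V assume V: "V \<in> T" "\<forall>W\<in>T. trace_metric A V W = 0"
  let ?W = "A ** transpose (matrix_inv A ** V)"
  have "?W \<in> T"
    using assms(2) V(1) trace_metric_witness(2)[OF assms(1), of V] by auto
  then have "(matrix_inv A ** V) \<bullet> (matrix_inv A ** V) = 0"
    using V(2) trace_metric_witness(1)[OF assms(1), of V] by simp
  then show "V = 0"
    by (simp add: matrix_inv_mult_eq_0_iff[OF assms(1)])
qed

lemma open_GL: "open (GL :: (real^'n^'n) set)"
  and open_GL_pos: "open (GL_pos :: (real^'n^'n) set)"
proof -
  have c: "continuous_on UNIV (det :: real^'n^'n \<Rightarrow> real)"
    by (rule smooth_on_imp_continuous_on) (intro smooth_intros open_UNIV)
  have "open {A :: real^'n^'n. det A \<noteq> 0}"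
    by (intro open_Collect_neq c continuous_on_const)
  then show "open (GL :: (real^'n^'n) set)" by (simp add: GL_def invertible_det_nz)
  have "open {A :: real^'n^'n. 0 < det A}"
    by (intro open_Collect_less c continuous_on_const)
  moreover have "{A :: real^'n^'n. 0 < det A} = GL_pos"
    by (auto simp: GL_pos_def GL_def invertible_det_nz)
  ultimately show "open (GL_pos :: (real^'n^'n) set)" by simp
qed

lemma GL_pos_iff: "A \<in> GL_pos \<longleftrightarrow> 0 < det A" for A :: "real^'n^'n"
  by (auto simp: GL_pos_def GL_def invertible_det_nz)

lemma smooth_on_trace_metric:
  "smooth_on (\<lambda>(A, V, W). trace_metric A V W) ((GL :: (real^'n^'n) set) \<times> UNIV \<times> UNIV)"
  unfolding trace_metric_def split_beta
  by (intro smooth_intros open_Times open_GL open_UNIV) (auto simp: GL_def)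

lemma semi_riemannian_manifold_open_subset_GL:
  fixes M :: "(real^'n^'n) set"
  assumes "open M" "M \<subseteq> GL"
  shows "semi_riemannian_manifold M trace_metric"
  unfolding semi_riemannian_manifold_def semi_riemannian_metric_def
proof (intro conjI)
  have inv: "invertible p" if "p \<in> M" for p using assms(2) that by (auto simp: GL_def)
  show "\<exists>d. embedded_submanifold d M"
    using embedded_submanifold_open[OF assms(1)] by blast
  show "\<forall>p\<in>M. symmetric_bilinear_on (tangent_space M p) (trace_metric p) \<and>
      nondegenerate_on (tangent_space M p) (trace_metric p)"
    using assms(1) inv
    by (simp add: symmetric_bilinear_on_trace_metric tangent_space_open nondegenerate_on_trace_metric)
  show "\<exists>\<nu>. \<forall>p\<in>M. index_on (tangent_space M p) (trace_metric p) = \<nu>"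
  proof (intro exI ballI)
    fix p assume p: "p \<in> M"
    show "index_on (tangent_space M p) (trace_metric p) = index_on (UNIV :: (real^'n^'n) set) trace_form"
      unfolding tangent_space_open[OF assms(1) p]
      using matrix_inv_mult_image[OF inv[OF p], of "\<lambda>_. True"]
      by (intro index_on_linear_iso[where L = "\<lambda>V. matrix_inv p ** V"] linear_matrix_mult_right
          inj_matrix_inv_mult inv p) (auto simp: trace_metric_eq)
  qed
  show "\<forall>X Y. vector_field M X \<and> vector_field M Y \<longrightarrow> smooth_map M (\<lambda>p. trace_metric p (X p) (Y p))"
    using smooth_map_metric[OF open_GL assms(2) smooth_on_trace_metric] by (simp add: vector_field_def)
qed

section \<open>The special linear group\<close>

text \<open>The scalar is det A^(-1/n), written with \<open>exp\<close> and \<open>ln\<close> so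
  that the rules for these two functions give its smoothness and its derivative.\<close>

definition SL_part :: "real^'n^'n \<Rightarrow> real^'n^'n" where
  "SL_part A = exp (- (ln (det A) / real CARD('n))) *\<^sub>R A"

lemma SL_subset_GL_pos: "SL \<subseteq> GL_pos"
  by (auto simp: SL_def GL_pos_iff)

lemma invertible_SL: "P \<in> SL \<Longrightarrow> invertible P" for P :: "real^'n^'n"
  by (simp add: SL_def invertible_det_nz)

lemma SL_part_in_SL:
  fixes A :: "real^'n^'n"
  assumes "A \<in> GL_pos"
  shows "SL_part A \<in> SL"
proof -
  have "exp (- (ln (det A) / real CARD('n))) ^ CARD('n) = exp (- ln (det A))"
    by (simp flip: exp_of_nat_mult)
  also have "\<dots> = inverse (det A)"
    using assms by (simp add: exp_minus GL_pos_iff)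
  finally show ?thesis
    using assms by (simp add: SL_def SL_part_def det_scaleR GL_pos_iff)
qed

lemma SL_part_eq: "P \<in> SL \<Longrightarrow> SL_part P = P"
  by (simp add: SL_def SL_part_def)

lemma smooth_on_SL_part: "smooth_on SL_part GL_pos"
  unfolding SL_part_def[abs_def]
  by (intro smooth_intros open_GL_pos) (auto simp: GL_pos_iff)

lemma has_derivative_ln_det:
  fixes A :: "real^'n^'n"
  assumes "A \<in> GL_pos"
  shows "((\<lambda>X. ln (det X)) has_derivative (\<lambda>V. trace (matrix_inv A ** V))) (at A)"
proof -
  have A: "det A > 0" "invertible A" using assms by (auto simp: GL_pos_def GL_def)
  have "(\<lambda>V. det A * trace (matrix_inv A ** V) * inverse (det A)) = (\<lambda>V. trace (matrix_inv A ** V))"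
    using A(1) by (simp add: fun_eq_iff)
  with has_derivative_ln[OF A(1) has_derivative_det[OF A(2)]] show ?thesis
    by (simp only:)
qed

text \<open>The derivative is \<open>c\<close> times A (X - (tr X / n) 1) with X = A^-1 V. At a
  point of \<open>SL\<close> one has c = 1, so trace-free directions are fixed, as
  \<open>tangent_spaceI\<close> demands.\<close>

lemma has_derivative_SL_part:
  fixes A :: "real^'n^'n"
  assumes "A \<in> GL_pos"
  defines "c \<equiv> exp (- (ln (det A) / real CARD('n)))"
  shows "(SL_part has_derivative
    (\<lambda>V. c *\<^sub>R V - (c * trace (matrix_inv A ** V) / real CARD('n)) *\<^sub>R A)) (at A)"
proof -
  have "((\<lambda>X. - (ln (det X) / real CARD('n))) has_derivative
      (\<lambda>V. - (trace (matrix_inv A ** V) / real CARD('n)))) (at A)"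
    by (intro has_derivative_minus bounded_linear.has_derivative[OF bounded_linear_divide]
        has_derivative_ln_det assms(1))
  from has_derivative_scaleR[OF has_derivative_exp[OF this] has_derivative_ident]
  show ?thesis
    by (simp add: SL_part_def[abs_def] c_def mult.commute)
qed

text \<open>One inclusion differentiates det = 1 along a curve. For the other, the curve is the
  image under \<open>SL_part\<close> of the line through \<open>P\<close> in direction
  \<open>V\<close>.\<close>

lemma tangent_space_SL:
  fixes P :: "real^'n^'n"
  assumes "P \<in> SL"
  shows "tangent_space SL P = {V. trace (matrix_inv P ** V) = 0}"
proof (intro equalityI subsetI CollectI)
  fix V assume "V \<in> tangent_space SL P"
  from tangent_space_level_set_subset[OF this has_derivative_det[OF invertible_SL[OF assms]], of 1]
  show "trace (matrix_inv P ** V) = 0"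
    using assms by (simp add: SL_def)
next
  fix V assume V: "V \<in> {V. trace (matrix_inv P ** V) = 0}"
  have P: "P \<in> GL_pos" using assms SL_subset_GL_pos by blast
  show "V \<in> tangent_space SL P"
    by (rule tangent_spaceI[OF open_GL_pos P smooth_on_SL_part _ SL_part_eq[OF assms]
          has_derivative_SL_part[OF P]])
      (use V assms[unfolded SL_def] in \<open>auto simp: SL_part_in_SL\<close>)
qed

text \<open>The same two arguments, with the determinant of the first component as constant function
  and the retraction that applies \<open>SL_part\<close> to the first component and leaves the
  second alone.\<close>

lemma tangent_space_SL_times_line:
  fixes P :: "real^'n^'n" and x :: real
  assumes "P \<in> SL"
  shows "tangent_space (SL \<times> UNIV) (P, x) = {V. trace (matrix_inv P ** V) = 0} \<times> UNIV"
proof (intro equalityI subsetI)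
  fix v assume v: "v \<in> tangent_space (SL \<times> (UNIV :: real set)) (P, x)"
  have "((\<lambda>q. det (fst q)) has_derivative (\<lambda>v. det P * trace (matrix_inv P ** fst v))) (at (P, x))"
    by (rule has_derivative_compose[OF has_derivative_fst[OF has_derivative_ident]])
      (use has_derivative_det[OF invertible_SL[OF assms]] in simp)
  from tangent_space_level_set_subset[OF v this, of 1]
  show "v \<in> {V. trace (matrix_inv P ** V) = 0} \<times> UNIV"
    using assms by (cases v) (auto simp: SL_def)
next
  fix v :: "(real^'n^'n) \<times> real"
  assume v: "v \<in> {V. trace (matrix_inv P ** V) = 0} \<times> UNIV"
  have P: "P \<in> GL_pos" using assms SL_subset_GL_pos by blast
  let ?U = "(GL_pos :: (real^'n^'n) set) \<times> (UNIV :: real set)"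
  let ?c = "exp (- (ln (det P) / real CARD('n)))"
  have U: "open ?U" by (intro open_Times open_GL_pos open_UNIV)
  have s: "smooth_on (\<lambda>q. SL_part (fst q)) ?U"
    by (rule smooth_on_compose[OF smooth_on_SL_part]) (auto intro!: smooth_intros U open_GL_pos)
  have d: "((\<lambda>q. SL_part (fst q)) has_derivative
      (\<lambda>v. ?c *\<^sub>R fst v - (?c * trace (matrix_inv P ** fst v) / real CARD('n)) *\<^sub>R P)) (at (P, x))"
    by (rule has_derivative_compose[OF has_derivative_fst[OF has_derivative_ident]])
      (use has_derivative_SL_part[OF P] in simp)
  show "v \<in> tangent_space (SL \<times> UNIV) (P, x)"
  proof (rule tangent_spaceI[OF U])
    show "smooth_on (\<lambda>q. (SL_part (fst q), snd q)) ?U"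
      by (intro smooth_intros s U)
    show "((\<lambda>q. (SL_part (fst q), snd q)) has_derivative (\<lambda>v. (?c *\<^sub>R fst v -
        (?c * trace (matrix_inv P ** fst v) / real CARD('n)) *\<^sub>R P, snd v))) (at (P, x))"
      by (intro has_derivative_Pair d has_derivative_snd has_derivative_ident)
  qed (use v P SL_part_eq[OF assms] assms[unfolded SL_def] in \<open>auto simp: SL_part_in_SL\<close>)
qed

text \<open>If every cofactor of a row vanished, so would the determinant. An entry with nonzero
  cofactor gives the direction needed by \<open>embedded_submanifold_level_set\<close>, a matrix
  unit of norm 1.\<close>

lemma det_affine_entry:
  fixes A :: "real^'n^'n"
  assumes "det A \<noteq> 0"
  obtains i j :: 'n where "det (A + axis i (axis j 1)) \<noteq> det A"
    and "\<And>X t. det (X + t *\<^sub>R axis i (axis j 1)) = det X + t * (det (X + axis i (axis j 1)) - det X)"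
proof -
  \<comment> \<open>Any row will do; \<open>undefined\<close> merely names one.\<close>
  define i :: 'n where "i = undefined"
  have "\<exists>j. det (\<chi> k. if k = i then axis j 1 else A $ k) \<noteq> 0"
  proof (rule ccontr)
    assume "\<not> ?thesis"
    then have "det A = 0" by (subst det_expand_row[of A i]) simp
    with assms show False by simp
  qed
  then obtain j where j: "det (\<chi> k. if k = i then axis j 1 else A $ k) \<noteq> 0" ..
  show thesis
  proof (rule that)
    show "det (A + axis i (axis j 1)) \<noteq> det A"
      using det_add_entry[of A 1 i j] j by simp
    show "det (X + t *\<^sub>R axis i (axis j 1)) = det X + t * (det (X + axis i (axis j 1)) - det X)" for X t
      using det_add_entry[of X t i j] det_add_entry[of X 1 i j] by simp
  qed
qed

lemma embedded_submanifold_SL: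
  "embedded_submanifold (DIM(real^'n^'n) - 1) (SL :: (real^'n^'n) set)"
proof -
  have "embedded_submanifold (DIM(real^'n^'n) - 1) {A :: real^'n^'n. det A - 1 = 0}"
  proof (rule embedded_submanifold_level_set)
    show "smooth_on (\<lambda>A :: real^'n^'n. det A - 1) UNIV"
      by (intro smooth_intros open_UNIV)
    fix P :: "real^'n^'n" assume "det P - 1 = 0"
    then obtain i j where "det (P + axis i (axis j 1)) \<noteq> det P"
      "\<And>X t. det (X + t *\<^sub>R axis i (axis j 1)) = det X + t * (det (X + axis i (axis j 1)) - det X)"
      using det_affine_entry[of P] by auto
    then show "\<exists>e. norm e = 1 \<and> det (P + e) - 1 \<noteq> det P - 1 \<and>
        (\<forall>X t. det (X + t *\<^sub>R e) - 1 = det X - 1 + t * (det (X + e) - 1 - (det X - 1)))"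
      by (intro exI[of _ "axis i (axis j 1)"]) (simp add: norm_Basis axis_in_Basis_iff)
  qed
  then show ?thesis by (simp add: SL_def)
qed

lemma embedded_submanifold_SL_times_line:
  "embedded_submanifold (DIM((real^'n^'n) \<times> real) - 1) ((SL :: (real^'n^'n) set) \<times> (UNIV :: real set))"
proof -
  have "embedded_submanifold (DIM((real^'n^'n) \<times> real) - 1)
      {q :: (real^'n^'n) \<times> real. det (fst q) - 1 = 0}"
  proof (rule embedded_submanifold_level_set)
    show "smooth_on (\<lambda>q :: (real^'n^'n) \<times> real. det (fst q) - 1) UNIV"
      by (intro smooth_intros open_UNIV)
    fix q :: "(real^'n^'n) \<times> real" assume "det (fst q) - 1 = 0"
    then obtain i j where "det (fst q + axis i (axis j 1)) \<noteq> det (fst q)"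
      "\<And>X t. det (X + t *\<^sub>R axis i (axis j 1)) = det X + t * (det (X + axis i (axis j 1)) - det X)"
      using det_affine_entry[of "fst q"] by auto
    then show "\<exists>e. norm e = 1 \<and> det (fst (q + e)) - 1 \<noteq> det (fst q) - 1 \<and>
        (\<forall>x t. det (fst (x + t *\<^sub>R e)) - 1 =
          det (fst x) - 1 + t * (det (fst (x + e)) - 1 - (det (fst x) - 1)))"
      by (intro exI[of _ "(axis i (axis j 1), 0)"]) (simp add: norm_Basis axis_in_Basis_iff norm_Pair)
  qed
  moreover have "{q :: (real^'n^'n) \<times> real. det (fst q) - 1 = 0} = SL \<times> UNIV"
    by (auto simp: SL_def)
  ultimately show ?thesis by simp
qed

section \<open>The metrics on the special linear group, the line and their product\<close>

lemma semi_riemannian_manifold_SL: "semi_riemannian_manifold (SL :: (real^'n^'n) set) trace_metric"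
  unfolding semi_riemannian_manifold_def semi_riemannian_metric_def
proof (intro conjI)
  show "\<exists>d. embedded_submanifold d (SL :: (real^'n^'n) set)"
    using embedded_submanifold_SL by blast
  show "\<forall>p\<in>SL. symmetric_bilinear_on (tangent_space SL p) (trace_metric p) \<and>
      nondegenerate_on (tangent_space SL p) (trace_metric (p :: real^'n^'n))"
    by (simp add: symmetric_bilinear_on_trace_metric tangent_space_SL nondegenerate_on_trace_metric
        invertible_SL)
  show "\<exists>\<nu>. \<forall>p\<in>SL. index_on (tangent_space SL p) (trace_metric (p :: real^'n^'n)) = \<nu>"
  proof (intro exI ballI)
    fix p :: "real^'n^'n" assume p: "p \<in> SL"
    show "index_on (tangent_space SL p) (trace_metric p) = index_on {X :: real^'n^'n. trace X = 0} trace_form"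
      unfolding tangent_space_SL[OF p]
      by (intro index_on_linear_iso[where L = "\<lambda>V. matrix_inv p ** V"] linear_matrix_mult_right
          inj_matrix_inv_mult invertible_SL p matrix_inv_mult_image) (simp add: trace_metric_eq)
  qed
  have "(SL :: (real^'n^'n) set) \<subseteq> GL" by (auto simp: GL_def invertible_SL)
  then show "\<forall>X Y. vector_field SL X \<and> vector_field SL Y \<longrightarrow>
      smooth_map (SL :: (real^'n^'n) set) (\<lambda>p. trace_metric p (X p) (Y p))"
    by (intro allI impI smooth_map_metric[OF open_GL _ smooth_on_trace_metric])
      (simp_all add: vector_field_def)
qed

lemma semi_riemannian_manifold_line: "semi_riemannian_manifold UNIV line_metric"
  unfolding semi_riemannian_manifold_def semi_riemannian_metric_def
proof (intro conjI)
  show "\<exists>d. embedded_submanifold d (UNIV :: real set)"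
    using embedded_submanifold_open[OF open_UNIV] by blast
  show "\<forall>p\<in>UNIV. symmetric_bilinear_on (tangent_space UNIV p) (line_metric p) \<and>
      nondegenerate_on (tangent_space UNIV p) (line_metric p)"
    by (auto simp: tangent_space_open symmetric_bilinear_on_def nondegenerate_on_def line_metric_def
        algebra_simps)
  show "\<exists>\<nu>. \<forall>p\<in>UNIV. index_on (tangent_space UNIV p) (line_metric p) = \<nu>"
    by (simp add: tangent_space_open line_metric_def[abs_def])
  have "smooth_on (\<lambda>(p, v, w). line_metric p v w) (UNIV \<times> UNIV \<times> UNIV)"
    unfolding line_metric_def split_beta by (intro smooth_intros open_Times open_UNIV)
  from smooth_map_metric[OF open_UNIV order_refl this]
  show "\<forall>X Y. vector_field UNIV X \<and> vector_field UNIV Y \<longrightarrow>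
      smooth_map UNIV (\<lambda>p. line_metric p (X p) (Y p))"
    by (simp add: vector_field_def)
qed

lemma product_metric_line_eq:
  "product_metric g line_metric q v w = g (fst q) (fst v) (fst w) + snd v * snd w"
  by (simp add: product_metric_def line_metric_def split_beta)

lemma semi_riemannian_manifold_SL_times_line:
  "semi_riemannian_manifold ((SL :: (real^'n^'n) set) \<times> (UNIV :: real set))
    (product_metric trace_metric line_metric)"
  unfolding semi_riemannian_manifold_def semi_riemannian_metric_def
proof (intro conjI)
  let ?M = "(SL :: (real^'n^'n) set) \<times> (UNIV :: real set)"
  let ?g = "product_metric trace_metric line_metric :: ((real^'n^'n) \<times> real) tensor"
  show "\<exists>d. embedded_submanifold d ?M"
    using embedded_submanifold_SL_times_line by blast
  show "\<forall>q\<in>?M. symmetric_bilinear_on (tangent_space ?M q) (?g q) \<and>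
      nondegenerate_on (tangent_space ?M q) (?g q)"
  proof
    fix q assume q: "q \<in> ?M"
    then obtain P x where [simp]: "q = (P, x)" and P: "P \<in> SL" by auto
    let ?T = "{V. trace (matrix_inv P ** V) = 0}"
    have T: "tangent_space ?M q = ?T \<times> UNIV" by (simp add: tangent_space_SL_times_line P)
    have "symmetric_bilinear_on (?T \<times> UNIV) (?g q)"
      using symmetric_bilinear_on_trace_metric[of ?T P]
      by (auto simp: symmetric_bilinear_on_def product_metric_line_eq algebra_simps)
    moreover have "nondegenerate_on (?T \<times> UNIV) (?g q)"
      unfolding nondegenerate_on_def
    proof (intro ballI impI)
      fix v assume v: "v \<in> ?T \<times> (UNIV :: real set)" and 0: "\<forall>w\<in>?T \<times> UNIV. ?g q v w = 0"
      have "trace_metric P (fst v) W = 0" if "W \<in> ?T" for W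
        using bspec[OF 0, of "(W, 0)"] that by (simp add: product_metric_line_eq)
      then have "fst v = 0"
        using nondegenerate_on_trace_metric[OF invertible_SL[OF P], of ?T] v
        by (auto simp: nondegenerate_on_def)
      moreover have "snd v = 0"
        using bspec[OF 0, of "(0, snd v)"] linear_0[OF linear_matrix_mult_right] trace_0
        by (simp add: product_metric_line_eq trace_metric_def)
      ultimately show "v = 0" by (simp add: prod_eq_iff)
    qed
    ultimately show "symmetric_bilinear_on (tangent_space ?M q) (?g q) \<and>
        nondegenerate_on (tangent_space ?M q) (?g q)"
      by (simp only: T)
  qed
  show "\<exists>\<nu>. \<forall>q\<in>?M. index_on (tangent_space ?M q) (?g q) = \<nu>"
  proof (intro exI ballI)
    fix q assume q: "q \<in> ?M"
    then obtain P x where [simp]: "q = (P, x)" and P: "P \<in> SL" by auto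
    \<comment> \<open>Left translation in the matrix factor only: the metric of the line is already
      the same at every point.\<close>
    let ?L = "\<lambda>v :: (real^'n^'n) \<times> real. (matrix_inv P ** fst v, snd v)"
    note lin = linear_matrix_mult_right[of "matrix_inv P"]
    have "linear ?L"
      by (rule linearI) (simp_all add: linear_add[OF lin] linear_cmul[OF lin])
    moreover have "inj ?L"
      using inj_matrix_inv_mult[OF invertible_SL[OF P]] by (auto simp: inj_def prod_eq_iff)
    moreover have "?L ` ({V. trace (matrix_inv P ** V) = 0} \<times> UNIV) = {X. trace X = 0} \<times> UNIV"
      using matrix_inv_mult_image[OF invertible_SL[OF P], of "\<lambda>X. trace X = 0"]
      by (force simp: image_iff set_eq_iff)
    ultimately show "index_on (tangent_space ?M q) (?g q) =
        index_on ({X :: real^'n^'n. trace X = 0} \<times> (UNIV :: real set))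
          (\<lambda>v w. trace_form (fst v) (fst w) + snd v * snd w)"
      unfolding \<open>q = (P, x)\<close> tangent_space_SL_times_line[OF P]
      by (rule index_on_linear_iso) (simp add: product_metric_line_eq trace_metric_eq)
  qed
  have "smooth_on (\<lambda>(q, v, w). ?g q v w) ((GL \<times> UNIV) \<times> UNIV \<times> UNIV)"
    unfolding product_metric_line_eq trace_metric_def split_beta
    by (intro smooth_intros open_Times open_GL open_UNIV) (auto simp: GL_def)
  moreover have "?M \<subseteq> GL \<times> UNIV" by (auto simp: GL_def invertible_SL)
  moreover have "open ((GL :: (real^'n^'n) set) \<times> (UNIV :: real set))"
    by (intro open_Times open_GL open_UNIV)
  ultimately show "\<forall>X Y. vector_field ?M X \<and> vector_field ?M Y \<longrightarrow>
      smooth_map ?M (\<lambda>q. ?g q (X q) (Y q))"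
    using smooth_map_metric[of "GL \<times> UNIV" ?M ?g] by (simp add: vector_field_def)
qed

section \<open>The isometry\<close>

lemma ln_det_exp_scaleR:
  fixes P :: "real^'n^'n"
  assumes "P \<in> SL"
  shows "ln (det (exp t *\<^sub>R P)) = real CARD('n) * t" "exp t *\<^sub>R P \<in> GL_pos"
  using assms by (simp_all add: SL_def det_scaleR GL_pos_iff flip: exp_of_nat_mult)

lemma diffeomorphism_GL_pos:
  "diffeomorphism (GL_pos :: (real^'n^'n) set) (SL \<times> (UNIV :: real set))
    (\<lambda>A. (SL_part A, ln (det A) / sqrt (real CARD('n))))
    (\<lambda>q. exp (snd q / sqrt (real CARD('n))) *\<^sub>R fst q)"
proof (rule diffeomorphismI)
  let ?n = "real CARD('n)"
  have n: "?n > 0" by simp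
  then have sq: "sqrt ?n * sqrt ?n = ?n" by simp
  have "smooth_on (\<lambda>A :: real^'n^'n. (SL_part A, ln (det A) / sqrt ?n)) GL_pos"
    by (intro smooth_intros smooth_on_SL_part open_GL_pos) (auto simp: GL_pos_iff)
  then show "smooth_map GL_pos (\<lambda>A :: real^'n^'n. (SL_part A, ln (det A) / sqrt ?n))"
    by (rule smooth_mapI_open[OF open_GL_pos order_refl])
  have "smooth_on (\<lambda>q :: (real^'n^'n) \<times> real. exp (snd q / sqrt ?n) *\<^sub>R fst q) UNIV"
    by (intro smooth_intros open_UNIV) simp
  then show "smooth_map (SL \<times> UNIV) (\<lambda>q :: (real^'n^'n) \<times> real. exp (snd q / sqrt ?n) *\<^sub>R fst q)"
    by (rule smooth_mapI_open[OF open_UNIV subset_UNIV])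
  show "(SL_part A, ln (det A) / sqrt ?n) \<in> SL \<times> UNIV \<and>
      exp (snd (SL_part A, ln (det A) / sqrt ?n) / sqrt ?n) *\<^sub>R
        fst (SL_part A, ln (det A) / sqrt ?n) = A"
    if "A \<in> GL_pos" for A :: "real^'n^'n"
    using SL_part_in_SL[OF that] by (simp add: SL_part_def sq flip: exp_add)
  show "exp (snd q / sqrt ?n) *\<^sub>R fst q \<in> GL_pos \<and>
      (SL_part (exp (snd q / sqrt ?n) *\<^sub>R fst q),
        ln (det (exp (snd q / sqrt ?n) *\<^sub>R fst q)) / sqrt ?n) = q"
    if "q \<in> SL \<times> UNIV" for q :: "(real^'n^'n) \<times> real"
  proof -
    have P: "fst q \<in> SL" using that by auto
    \<comment> \<open>With t = x / sqrt n the matrix exp(t) P has log-determinant n t; the second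
      coordinate divides this by sqrt n and must return x.\<close>
    have "?n * (snd q / sqrt ?n) / sqrt ?n = snd q"
      using n sq by (simp add: field_simps)
    then show ?thesis
      using ln_det_exp_scaleR[OF P] n
      by (simp add: SL_part_def prod_eq_iff flip: exp_add)
  qed
qed

text \<open>For s = tr X / n and t = tr Y / n the last three terms collapse to - tr X tr Y / n,
  exactly what the line coordinate adds back in the isometry.\<close>

lemma trace_form_diff_mat:
  fixes X Y :: "real^'n^'n"
  shows "trace_form (X - s *\<^sub>R mat 1) (Y - t *\<^sub>R mat 1) =
    trace_form X Y - t * trace X - s * trace Y + s * t * real CARD('n)"
  by (simp add: matrix_mult_diff_distrib trace_sub trace_add trace_scaleR trace_I
      matrix_scalar_ac algebra_simps
      flip: scalar_matrix_assoc)

lemma isometric_GL_pos: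
  "isometric (GL_pos :: (real^'n^'n) set) trace_metric
    ((SL :: (real^'n^'n) set) \<times> (UNIV :: real set)) (product_metric trace_metric line_metric)"
proof -
  let ?n = "real CARD('n)"
  let ?F = "\<lambda>A :: real^'n^'n. (SL_part A, ln (det A) / sqrt ?n)"
  have isom: "product_metric trace_metric line_metric (?F A) (differential GL_pos ?F A V)
      (differential GL_pos ?F A W) = trace_metric A V W"
    if A: "A \<in> GL_pos" and V: "V \<in> tangent_space GL_pos A" and W: "W \<in> tangent_space GL_pos A"
    for A V W
  proof -
    have detA: "det A > 0" and inv: "invertible A" using A by (auto simp: GL_pos_def GL_def)
    define c where "c = exp (- (ln (det A) / ?n))"
    have c: "c > 0" by (simp add: c_def)
    define tr where "tr U = trace (matrix_inv A ** U)" for U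
    define D where "D U = (c *\<^sub>R U - (c * tr U / ?n) *\<^sub>R A, tr U / sqrt ?n)" for U
    have "((\<lambda>A. ln (det A) / sqrt ?n) has_derivative (\<lambda>U. tr U / sqrt ?n)) (at A)"
      unfolding tr_def
      by (intro bounded_linear.has_derivative[OF bounded_linear_divide] has_derivative_ln_det A)
    then have "(?F has_derivative D) (at A)"
      unfolding D_def[abs_def] using has_derivative_SL_part[OF A]
      by (intro has_derivative_Pair) (simp_all add: c_def tr_def)
    then have diff: "differential GL_pos ?F A U = D U" if "U \<in> tangent_space GL_pos A" for U
      by (rule differential_eq[OF that _ open_UNIV]) simp_all
    have "SL_part A ** ((1 / c) *\<^sub>R matrix_inv A) = mat 1"
      using c by (simp add: SL_part_def c_def[symmetric] matrix_scalar_ac matrix_inv_right[OF inv]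
          flip: scalar_matrix_assoc)
    then have inv_part: "matrix_inv (SL_part A) = (1 / c) *\<^sub>R matrix_inv A"
      by (rule matrix_inv_eqI)
    \<comment> \<open>The factor \<open>1 / c\<close> of the inverse cancels the \<open>c\<close> in
      the differential, leaving the trace-free part of A^-1 U.\<close>
    have part: "matrix_inv (SL_part A) ** fst (D U) = matrix_inv A ** U - (tr U / ?n) *\<^sub>R mat 1" for U
      using c by (simp add: inv_part D_def matrix_mult_diff_distrib matrix_scalar_ac
          matrix_inv_left[OF inv] scaleR_diff_right flip: scalar_matrix_assoc)
    have "product_metric trace_metric line_metric (?F A) (D V) (D W) =
        trace_form (matrix_inv A ** V - (tr V / ?n) *\<^sub>R mat 1) (matrix_inv A ** W - (tr W / ?n) *\<^sub>R mat 1)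
        + (tr V / sqrt ?n) * (tr W / sqrt ?n)"
      by (simp add: product_metric_line_eq trace_metric_eq part) (simp add: D_def)
    also have "\<dots> = trace_metric A V W"
      by (simp add: trace_form_diff_mat trace_metric_eq tr_def[symmetric] field_simps)
    finally show ?thesis
      by (simp only: diff[OF V] diff[OF W])
  qed
  show ?thesis
    unfolding isometric_def isometry_between_def
    by (intro exI[of _ ?F] conjI exI[of _ "\<lambda>q. exp (snd q / sqrt ?n) *\<^sub>R fst q"]
        ballI isom diffeomorphism_GL_pos)
qed

theorem theorem4p2:
  shows "open_semi_riemannian_submanifold (GL_pos :: (real^'n^'n) set) GL trace_metric \<and>
    semi_riemannian_manifold (SL :: (real^'n^'n) set) trace_metric \<and>
    semi_riemannian_manifold (UNIV :: real set) line_metric \<and>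
    semi_riemannian_manifold ((SL :: (real^'n^'n) set) \<times> (UNIV :: real set))
      (product_metric trace_metric line_metric) \<and>
    isometric (GL_pos :: (real^'n^'n) set) trace_metric
      ((SL :: (real^'n^'n) set) \<times> (UNIV :: real set)) (product_metric trace_metric line_metric)"
proof -
  have sub: "(GL_pos :: (real^'n^'n) set) \<subseteq> GL" by (auto simp: GL_pos_def)
  have "open_semi_riemannian_submanifold (GL_pos :: (real^'n^'n) set) GL trace_metric"
    unfolding open_semi_riemannian_submanifold_def
    using sub by (auto intro!: semi_riemannian_manifold_open_subset_GL open_GL open_GL_pos
        open_subset)
  then show ?thesis
    using semi_riemannian_manifold_SL semi_riemannian_manifold_line
      semi_riemannian_manifold_SL_times_line isometric_GL_pos by blast
qed

end
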